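(* If $H$ is a tree on at most four vertices, then $\{H,H\}$ is unavoidable in $\mathcal{K}_{\mathrm{MP}}$.
   Context: All graphs are finite and simple; copies are subgraphs, not necessarily induced. A graph is maximal planar if it is planar and adding any edge between two non-adjacent vertices destroys planarity; $\mathcal{K}_{\mathrm{MP}}$ is the class of all maximal planar graphs. A pair $\{H,F\}$ is unavoidable in $\mathcal{K}_{\mathrm{MP}}$ if there exists $N$ such that for every maximal planar graph $G$ on at least $N$ vertices, every red/blue colouring of the edges of $G$ contains a red copy of $H$ or a blue copy of $F$. *)

theory Defs
  imports "HOL-Analysis.Analysis"
begin

record 'a ugraph =
  verts :: "'a set"
  edges :: "'a set set"

definition simple_graph :: "'a ugraph \<Rightarrow> bool" where
  "simple_graph G \<longleftrightarrow>
     finite (verts G) \<and> (\<forall>e\<in>edges G. e \<subseteq> verts G \<and> card e = 2)"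

definition add_edge :: "'a ugraph \<Rightarrow> 'a \<Rightarrow> 'a \<Rightarrow> 'a ugraph" where
  "add_edge G u v = G\<lparr>edges := insert {u, v} (edges G)\<rparr>"

definition connected_graph :: "'a ugraph \<Rightarrow> bool" where
  "connected_graph G \<longleftrightarrow>
     verts G \<noteq> {} \<and>
     (\<forall>u\<in>verts G. \<forall>v\<in>verts G. (u, v) \<in> {(x, y). {x, y} \<in> edges G}\<^sup>*)"

definition is_cycle :: "'a ugraph \<Rightarrow> 'a list \<Rightarrow> bool" where
  "is_cycle G xs \<longleftrightarrow>
     3 \<le> length xs \<and> distinct xs \<and>
     (\<forall>i<length xs. {xs ! i, xs ! (Suc i mod length xs)} \<in> edges G)"

definition tree :: "'a ugraph \<Rightarrow> bool" where
  "tree G \<longleftrightarrow> simple_graph G \<and> connected_graph G \<and> (\<nexists>xs. is_cycle G xs)"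

(* A crossing-free drawing in the plane: distinct vertices go to distinct points, every edge
   to a (continuous, injective) arc between the images of its two ends that meets no other
   vertex, and two different edges meet at most in the image of a common end. *)
definition plane_drawing :: "'a ugraph \<Rightarrow> ('a \<Rightarrow> complex) \<Rightarrow> ('a set \<Rightarrow> real \<Rightarrow> complex) \<Rightarrow> bool" where
  "plane_drawing G pos crv \<longleftrightarrow>
     inj_on pos (verts G) \<and>
     (\<forall>e\<in>edges G. arc (crv e) \<and> {pathstart (crv e), pathfinish (crv e)} = pos ` e \<and>
                  path_image (crv e) \<inter> pos ` verts G = pos ` e) \<and>
     (\<forall>e\<in>edges G. \<forall>e'\<in>edges G. e \<noteq> e' \<longrightarrow>
                  path_image (crv e) \<inter> path_image (crv e') = pos ` (e \<inter> e'))"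

definition planar :: "'a ugraph \<Rightarrow> bool" where
  "planar G \<longleftrightarrow> simple_graph G \<and> (\<exists>pos crv. plane_drawing G pos crv)"

definition maximal_planar :: "'a ugraph \<Rightarrow> bool" where
  "maximal_planar G \<longleftrightarrow>
     planar G \<and>
     (\<forall>u\<in>verts G. \<forall>v\<in>verts G. u \<noteq> v \<and> {u, v} \<notin> edges G \<longrightarrow> \<not> planar (add_edge G u v))"

definition K_MP :: "'a ugraph set" where
  "K_MP = {G. maximal_planar G}"

datatype colour = Red | Blue

(* Only the values of a colouring on edges matter. *)
definition has_mono_copy :: "'b ugraph \<Rightarrow> ('b set \<Rightarrow> colour) \<Rightarrow> colour \<Rightarrow> 'a ugraph \<Rightarrow> bool" where
  "has_mono_copy G col c H \<longleftrightarrow>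
     (\<exists>f. inj_on f (verts H) \<and> f ` verts H \<subseteq> verts G \<and>
          (\<forall>e\<in>edges H. f ` e \<in> edges G \<and> col (f ` e) = c))"

definition unavoidable :: "'b ugraph set \<Rightarrow> 'a ugraph \<Rightarrow> 'c ugraph \<Rightarrow> bool" where
  "unavoidable K H F \<longleftrightarrow>
     (\<exists>N. \<forall>G\<in>K. N \<le> card (verts G) \<longrightarrow>
        (\<forall>col. has_mono_copy G col Red H \<or> has_mono_copy G col Blue F))"

end

theory Submission
  imports Defs
begin

text \<open>
A tree on at most four vertices is a star with at most three leaves or the path on four vertices.
Every maximal planar graph with at least seven vertices has a vertex \<open>v\<close> of degree at least five
(\<open>maximal_planar_has_degree_five\<close>), and such a vertex yields both kinds of monochromatic tree. For
stars this is the pigeonhole principle. For the path, the neighbours of \<open>v\<close> form a cycle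
(\<open>maximal_planar_link\<close>): some colour \<open>c\<close> occurs on three spokes of this wheel, and unless there is a path
in colour \<open>c\<close> all rim edges at those spokes have the other colour; two such spokes close to each
other on the rim give three consecutive rim edges of the other colour, and among at least five spokes a
close pair can always be found for one of the two colours (\<open>maximal_planar_mono_path4\<close>).

The existence of a vertex of degree at least five needs no count of edges. It follows from two
facts: the graph is connected, and the neighbours of every vertex form a cycle. If all degrees
were at most four, these facts determine the surroundings of a vertex of maximum degree completely
and the graph would close up with at most six vertices, the octahedron being the extreme case.

Both facts come from one principle: two vertices in the closure of a common face can be joined by a
new edge, so in a maximal planar graph they are adjacent. For connectedness, a shortest segment
between two parts of the drawing crosses a single face. For the cycle, the sector between two
consecutive edges at a vertex lies in a face. In both cases the face is first only known to
touch certain edges, and Janiszewski's theorem shows that a face touching the interior of an edge has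
both ends of the edge in its closure (\<open>ends_in_closure_component\<close>). To have well-defined sectors, and to reach
a vertex from a face, the drawing is first modified in small discs around the vertices so that
all edges start along straight spokes (\<open>exists_spoked_drawing\<close>).
\<close>

section \<open>Faces that touch the interior of an arc\<close>

text \<open>If the face stayed away from the far
end of the arc, its frontier would already lie in \<open>K\<close> together with an initial piece of the arc.
This piece meets \<open>K\<close> in at most its starting point, so by Janiszewski's theorem it does not separate
what \<open>K\<close> does not separate; hence the face could be left through the removed part of the arc
without crossing its frontier.\<close>

lemma pathfinish_in_closure_component:
  fixes g :: "real \<Rightarrow> complex"
  assumes g: "arc g" and K: "closed K"
    and gK: "path_image g \<inter> K \<subseteq> {pathstart g, pathfinish g}"
    and F: "F \<in> components (- (K \<union> path_image g))"
    and p: "p \<in> path_image g" "p \<noteq> pathstart g" "p \<noteq> pathfinish g" "p \<in> closure F"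
  shows "pathfinish g \<in> closure F"
proof (rule ccontr)
  assume notin: "pathfinish g \<notin> closure F"
  have inj: "inj_on g {0..1}" and cont: "continuous_on {0..1} g"
    using g by (auto simp: arc_def path_def)
  obtain t0 where t0: "0 \<le> t0" "t0 \<le> 1" "p = g t0"
    using p(1) by (auto simp: path_image_def)
  have t0': "0 < t0" "t0 < 1"
    using t0 p(2,3) by (auto simp: pathstart_def pathfinish_def order_less_le)
  obtain d where d: "d > 0" "\<And>t. t \<in> {0..1} \<Longrightarrow> dist t 1 < d \<Longrightarrow> g t \<notin> closure F"
  proof -
    have "open (- closure F)" by auto
    moreover have "g 1 \<in> - closure F" using notin by (simp add: pathfinish_def)
    ultimately obtain e where e: "e > 0" "ball (g 1) e \<subseteq> - closure F"
      by (meson open_contains_ball)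
    obtain d where "d > 0" "\<forall>t\<in>{0..1}. dist t 1 < d \<longrightarrow> dist (g t) (g 1) < e"
      using cont e(1) unfolding continuous_on_iff by (metis atLeastAtMost_iff order_refl zero_le_one)
    then show thesis using e(2) by (intro that[of d]) (force simp: dist_commute)+
  qed
  \<comment> \<open>From parameter \<open>s\<close> on the arc is away from the face; \<open>w\<close> is a point in the interior of that final piece.\<close>
  define s where "s = max ((t0 + 1) / 2) (1 - d / 2)"
  have s: "t0 < s" "s < 1" "0 < s" using t0' d(1) by (auto simp: s_def less_max_iff_disj)
  have out: "g t \<notin> closure F" if "s \<le> t" "t \<le> 1" for t
    using that s d(1) by (intro d(2)) (auto simp: s_def dist_real_def field_simps max_def split: if_splits)
  define e1 where "e1 = path_image (subpath 0 s g)"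
  have e1: "e1 = g ` {0..s}" using s by (simp add: e1_def path_image_subpath)
  have arc1: "arc (subpath 0 s g)"
    using g s by (intro arc_subpath_arc) auto
  define s' where "s' = (s + 1) / 2"
  have s': "s < s'" "s' < 1" using s by (auto simp: s'_def)
  define w where "w = g s'"
  have w_e1: "w \<notin> e1"
  proof
    assume "w \<in> e1"
    then obtain t where "0 \<le> t" "t \<le> s" "g t = g s'" by (auto simp: e1 w_def)
    then have "t = s'" using s s' by (intro inj_onD[OF inj]) auto
    then show False using \<open>t \<le> s\<close> s'(1) by simp
  qed
  have notK: "g t \<notin> K" if "0 < t" "t < 1" for t
  proof
    assume "g t \<in> K"
    moreover have "g t \<in> path_image g" using that by (auto simp: path_image_def)
    ultimately have "g t = g 0 \<or> g t = g 1"
      using gK by (auto simp: pathstart_def pathfinish_def)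
    then have "t = 0 \<or> t = 1"
      using inj_onD[OF inj, of t 0] inj_onD[OF inj, of t 1] that by auto
    then show False using that by auto
  qed
  have pK: "p \<notin> K" using notK t0 t0' by auto
  obtain r where r: "r > 0" "ball p r \<subseteq> - K"
    using K pK by (metis ComplI open_Compl open_contains_ball)
  obtain z where z: "z \<in> F" "dist z p < r"
    using p(4) r(1) by (meson closure_approachable)
  have FD: "F \<inter> (K \<union> path_image g) = {}"
    using F in_components_subset by fastforce
  have e1g: "e1 \<subseteq> path_image g" using s by (auto simp: e1 path_image_def)
  \<comment> \<open>Neither the initial piece nor \<open>K\<close> separates \<open>z\<close> from \<open>w\<close>, so neither does their union.\<close>
  have "connected_component (- (e1 \<union> K)) z w"
  proof (rule Janiszewski)
    show "compact e1" using arc1 by (simp add: e1_def compact_arc_image)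
    have "e1 \<inter> K \<subseteq> {g 0}"
    proof
      fix x assume "x \<in> e1 \<inter> K"
      then obtain t where t: "0 \<le> t" "t \<le> s" "x = g t" "g t \<in> K" by (auto simp: e1)
      then show "x \<in> {g 0}" using notK[of t] s by (cases "t = 0") auto
    qed
    then have "e1 \<inter> K = {} \<or> e1 \<inter> K = {g 0}" by blast
    then show "connected (e1 \<inter> K)" by auto
    have "connected (- e1)" unfolding e1_def using arc1 by (intro connected_arc_complement) auto
    moreover have "z \<in> - e1" using FD z(1) e1g by auto
    ultimately show "connected_component (- e1) z w"
      using w_e1 by (auto simp: connected_component_def)
    let ?C = "ball p r \<union> g ` {t0..s'}"
    have "connected (g ` {t0..s'})"
      using s s' t0' by (intro connected_continuous_image continuous_on_subset[OF cont]) auto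
    moreover have "p \<in> ball p r" "p \<in> g ` {t0..s'}" using r(1) t0 s s' by auto
    ultimately have "connected ?C"
      by (intro connected_Un connected_ball) blast+
    moreover have "?C \<subseteq> - K" using r(2) notK t0' s' by force
    moreover have "z \<in> ?C" using z(2) by (auto simp: dist_commute)
    moreover have "w \<in> ?C" using s s' by (auto simp: w_def)
    ultimately show "connected_component (- K) z w"
      unfolding connected_component_def by blast
  qed (rule K)
  \<comment> \<open>But \<open>z\<close> lies in the face and \<open>w\<close> does not, so the connecting set crosses the frontier of the face.\<close>
  then obtain C where C: "connected C" "C \<subseteq> - (e1 \<union> K)" "z \<in> C" "w \<in> C"
    by (auto simp: connected_component_def)
  have "w \<in> path_image g" using s s' by (auto simp: w_def path_image_def)
  then have "C \<inter> frontier F \<noteq> {}"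
    using C z(1) FD by (intro connected_Int_frontier) auto
  then obtain y where y: "y \<in> C" "y \<in> frontier F" by auto
  have "closed (K \<union> path_image g)" using K g by (simp add: closed_Un closed_arc_image)
  then have "y \<in> K \<union> path_image g"
    using frontier_of_components_closed_complement F y(2) by blast
  have "y \<in> closure F" using y(2) by (simp add: frontier_def)
  from \<open>y \<in> K \<union> path_image g\<close> have "y \<in> K \<or> y \<in> e1"
  proof
    assume "y \<in> path_image g"
    then obtain t where t: "0 \<le> t" "t \<le> 1" "y = g t" by (auto simp: path_image_def)
    then have "t \<le> s" using out[of t] \<open>y \<in> closure F\<close> by force
    then show ?thesis using t by (auto simp: e1)
  qed auto
  then show False using y(1) C(2) by auto
qed

lemma ends_in_closure_component:
  fixes g :: "real \<Rightarrow> complex"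
  assumes g: "arc g" and K: "closed K"
    and gK: "path_image g \<inter> K \<subseteq> {pathstart g, pathfinish g}"
    and F: "F \<in> components (- (K \<union> path_image g))"
    and p: "p \<in> path_image g" "p \<in> closure F"
  shows "{pathstart g, pathfinish g} \<inter> closure F \<noteq> {}"
    and "p \<noteq> pathstart g \<Longrightarrow> p \<noteq> pathfinish g \<Longrightarrow> {pathstart g, pathfinish g} \<subseteq> closure F"
proof -
  show *: "{pathstart g, pathfinish g} \<subseteq> closure F" if "p \<noteq> pathstart g" "p \<noteq> pathfinish g"
    using pathfinish_in_closure_component[OF g K gK F p(1) _ _ p(2)]
      pathfinish_in_closure_component[of "reversepath g" K F p] assms that
    by (auto simp: arc_reversepath insert_commute)
  show "{pathstart g, pathfinish g} \<inter> closure F \<noteq> {}"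
    using * p(2) by blast
qed

section \<open>Straightening a drawing near its vertices\<close>

lemma last_point_in_cball:
  fixes g :: "real \<Rightarrow> 'a::real_normed_vector"
  assumes g: "continuous_on {a..b} g" and ab: "a \<le> b"
    and a: "dist x (g a) \<le> r" and b: "r < dist x (g b)"
  obtains t where "a \<le> t" "t < b" "dist x (g t) = r" "\<And>u. t < u \<Longrightarrow> u \<le> b \<Longrightarrow> r < dist x (g u)"
proof -
  define S where "S = {t \<in> {a..b}. dist x (g t) \<le> r}"
  have "compact S"
  proof -
    have "S = {a..b} \<inter> g -` cball x r" by (auto simp: S_def)
    then have "closed S" using continuous_closed_preimage[OF g] by simp
    then show ?thesis unfolding S_def using compact_Icc
      by (metis (no_types, lifting) bounded_closed_interval bounded_subset compact_eq_bounded_closed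
          mem_Collect_eq subsetI)
  qed
  moreover have "a \<in> S" using a ab by (auto simp: S_def)
  ultimately obtain t where t: "t \<in> S" "\<And>u. u \<in> S \<Longrightarrow> u \<le> t"
    using compact_attains_sup[of S] by blast
  have after: "r < dist x (g u)" if "t < u" "u \<le> b" for u
  proof (rule ccontr)
    assume "\<not> r < dist x (g u)"
    then have "u \<in> S" using that t(1) by (auto simp: S_def)
    then show False using t(2) that(1) by fastforce
  qed
  have tb: "t < b" using t(1) b by (force simp: S_def order_less_le)
  have "dist x (g t) = r"
  proof (rule ccontr)
    assume "dist x (g t) \<noteq> r"
    then have lt: "dist x (g t) < r" using t(1) by (auto simp: S_def)
    have "continuous_on {t..b} (\<lambda>u. dist x (g u))"
      using t(1) by (intro continuous_intros continuous_on_subset[OF g]) (auto simp: S_def)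
    then obtain u where "t \<le> u" "u \<le> b" "dist x (g u) = r"
      using IVT'[of "\<lambda>u. dist x (g u)" t r b] lt b tb by auto
    then show False using after[of u] lt by (cases "u = t") auto
  qed
  then show thesis using t(1) tb after by (intro that[of t]) (auto simp: S_def)
qed

text \<open>The arc may spiral around its ends. Cutting it where it last leaves the disc around its start and
then first enters the disc around its finish, and joining the two cut points to the centres by
radii, gives an arc that is straight inside both discs and unchanged outside of them.\<close>

lemma straighten_arc_ends:
  fixes g :: "real \<Rightarrow> 'a::real_normed_vector"
  assumes g: "arc g" and r: "0 < r" and far: "2 * r < dist (pathstart g) (pathfinish g)"
  obtains h y z where
    "arc h" "pathstart h = pathstart g" "pathfinish h = pathfinish g"
    "y \<in> path_image g" "dist (pathstart g) y = r"
    "z \<in> path_image g" "dist (pathfinish g) z = r"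
    "path_image h \<inter> cball (pathstart g) r = closed_segment (pathstart g) y"
    "path_image h \<inter> cball (pathfinish g) r = closed_segment (pathfinish g) z"
    "path_image h \<subseteq> path_image g \<union> cball (pathstart g) r \<union> cball (pathfinish g) r"
proof -
  define x x' where "x = pathstart g" and "x' = pathfinish g"
  have ends: "g 0 = x" "g 1 = x'" by (auto simp: x_def x'_def pathstart_def pathfinish_def)
  have inj: "inj_on g {0..1}" and cont: "continuous_on {0..1} g"
    using g by (auto simp: arc_def path_def)
  have far': "2 * r < dist x x'" using far by (simp add: x_def x'_def)
  obtain t1 where t1: "0 \<le> t1" "t1 < 1" "dist x (g t1) = r"
      "\<And>u. t1 < u \<Longrightarrow> u \<le> 1 \<Longrightarrow> r < dist x (g u)"
    using last_point_in_cball[OF cont, of x r] r far' ends by auto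
  have "r < dist x' (g t1)"
    using far' t1(3) dist_triangle[of x x' "g t1"] by (simp add: dist_commute)
  moreover have "continuous_on {t1..1} (\<lambda>u. g (t1 + 1 - u))"
    by (rule continuous_on_compose2[OF cont]) (use t1 in \<open>auto intro!: continuous_intros\<close>)
  \<comment> \<open>First entry into the second disc: last exit along the arc traversed backwards.\<close>
  ultimately obtain s where s: "t1 \<le> s" "s < 1" "dist x' (g (t1 + 1 - s)) = r"
      "\<And>u. s < u \<Longrightarrow> u \<le> 1 \<Longrightarrow> r < dist x' (g (t1 + 1 - u))"
    using last_point_in_cball[of t1 1 "\<lambda>u. g (t1 + 1 - u)" x' r] r t1(2) ends by auto
  define t2 where "t2 = t1 + 1 - s"
  have t2: "t1 < t2" "t2 \<le> 1" "dist x' (g t2) = r" using s by (auto simp: t2_def)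
  have t2': "r < dist x' (g u)" if "t1 \<le> u" "u < t2" for u
    using s(4)[of "t1 + 1 - u"] that by (auto simp: t2_def)
  define y z where "y = g t1" and "z = g t2"
  define m where "m = subpath t1 t2 g"
  have m_arc: "arc m" unfolding m_def using g t1 t2 by (intro arc_subpath_arc) auto
  have m_img: "path_image m = g ` {t1..t2}" using t2 by (simp add: m_def path_image_subpath)
  have m_ends: "pathstart m = y" "pathfinish m = z" by (auto simp: m_def y_def z_def)
  have dx: "dist x y = r" and dx': "dist x' z = r" using t1 t2 by (auto simp: y_def z_def)
  have segy: "closed_segment x y \<subseteq> cball x r" and segz: "closed_segment x' z \<subseteq> cball x' r"
    using dx dx' r by (intro closed_segment_subset; simp)+
  have disj: "cball x r \<inter> cball x' r = {}"
  proof -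
    have "dist x x' \<le> 2 * r" if "dist x p \<le> r" "dist x' p \<le> r" for p
      using that dist_triangle[of x x' p] by (simp add: dist_commute)
    then show ?thesis using far' by force
  qed
  have m_x: "path_image m \<inter> cball x r = {y}"
  proof -
    have "u = t1" if "t1 \<le> u" "u \<le> t2" "dist x (g u) \<le> r" for u
      using t1(4)[of u] t2(2) that by (cases "u = t1") auto
    then show ?thesis using t1(3) t2(1) by (fastforce simp: m_img y_def)
  qed
  have m_x': "path_image m \<inter> cball x' r = {z}"
  proof -
    have "u = t2" if "t1 \<le> u" "u \<le> t2" "dist x' (g u) \<le> r" for u
      using t2'[of u] that by (cases "u = t2") auto
    then show ?thesis using t2 by (fastforce simp: m_img z_def)
  qed
  define k where "k = m +++ linepath z x'"
  define h where "h = linepath x y +++ k"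
  have k_img: "path_image k = path_image m \<union> closed_segment x' z"
    by (simp add: k_def path_image_join m_ends closed_segment_commute)
  have h_img: "path_image h = closed_segment x y \<union> path_image m \<union> closed_segment x' z"
    using k_img by (simp add: h_def path_image_join m_ends k_def Un_assoc)
  have "arc k" unfolding k_def
    using m_arc dx' r m_x' segz
    by (intro arc_join) (auto simp: m_ends closed_segment_commute)
  moreover have "closed_segment x y \<inter> path_image k \<subseteq> {y}"
    using m_x segy segz disj by (auto simp: k_img)
  ultimately have "arc h" unfolding h_def
    using dx r by (intro arc_join) (auto simp: k_def m_ends)
  moreover have "path_image m \<subseteq> path_image g" unfolding m_def
    using t1 t2 by (intro path_image_subpath_subset) auto
  moreover have "y \<in> path_image m" "z \<in> path_image m" using m_ends by (metis pathstart_in_path_image pathfinish_in_path_image)+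
  moreover have "path_image h \<inter> cball x r = closed_segment x y"
    using segy segz disj m_x by (auto simp: h_img)
  moreover have "path_image h \<inter> cball x' r = closed_segment x' z"
    using segy segz disj m_x' by (auto simp: h_img)
  moreover have "path_image h \<subseteq> path_image g \<union> cball x r \<union> cball x' r"
    using \<open>path_image m \<subseteq> path_image g\<close> segy segz by (auto simp: h_img)
  ultimately show thesis
    using dx dx' by (intro that[of h y z]) (auto simp: h_def k_def m_ends x_def x'_def)
qed

lemma closed_segments_same_length_Int:
  fixes x :: "'a::real_normed_vector"
  assumes "dist x y = r" "dist x z = r" "0 < r" "y \<noteq> z"
  shows "closed_segment x y \<inter> closed_segment x z \<subseteq> {x}"
proof
  fix p assume "p \<in> closed_segment x y \<inter> closed_segment x z"
  then have "\<exists>s\<ge>0. p = (1 - s) *\<^sub>R x + s *\<^sub>R y" "\<exists>t\<ge>0. p = (1 - t) *\<^sub>R x + t *\<^sub>R z"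
    by (auto simp: in_segment)
  then obtain s t where s: "0 \<le> s" "p = x + s *\<^sub>R (y - x)" and t: "0 \<le> t" "p = x + t *\<^sub>R (z - x)"
    by (metis (no_types, opaque_lifting) add.commute add_diff_eq diff_add_eq scaleR_diff_right scaleR_left_diff_distrib scaleR_one)
  have "norm (p - x) = s * norm (y - x)" using s by simp
  moreover have "norm (p - x) = t * norm (z - x)" using t by simp
  moreover have "norm (y - x) = r" "norm (z - x) = r"
    using assms(1,2) by (auto simp: dist_norm norm_minus_commute)
  ultimately have "s = t" using assms by simp
  then have "s *\<^sub>R (y - x) = s *\<^sub>R (z - x)" 
    using s(2) t(2) by (metis add_left_imp_eq)
  moreover have "s *\<^sub>R (y - z) = s *\<^sub>R (y - x) - s *\<^sub>R (z - x)"
    by (simp add: scaleR_diff_right)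
  ultimately have "s *\<^sub>R (y - z) = 0" by simp
  then show "p \<in> {x}" using s assms(4) by (metis add.right_neutral eq_iff_diff_eq_0 scaleR_eq_0_iff scaleR_zero_left singletonI)
qed

definition neighbours :: "'a ugraph \<Rightarrow> 'a \<Rightarrow> 'a set" where
  "neighbours G v = {w. {v, w} \<in> edges G}"

definition drawn :: "'a ugraph \<Rightarrow> ('a \<Rightarrow> complex) \<Rightarrow> ('a set \<Rightarrow> real \<Rightarrow> complex) \<Rightarrow> complex set" where
  "drawn G pos crv = pos ` verts G \<union> (\<Union>e\<in>edges G. path_image (crv e))"

text \<open>A drawing that is a star of straight spokes in a disc around every vertex; \<open>tip v e\<close> is the point
where the edge \<open>e\<close> leaves the disc around \<open>v\<close>. The edges may still be wild elsewhere, but this is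
all the regularity needed: faces are accessible along straight segments from the vertices
on their frontier, and the edges at a vertex have a cyclic order.\<close>

locale spoked_drawing =
  fixes G :: "'a ugraph" and pos :: "'a \<Rightarrow> complex" and crv :: "'a set \<Rightarrow> real \<Rightarrow> complex"
    and r :: real and tip :: "'a \<Rightarrow> 'a set \<Rightarrow> complex"
  assumes simple: "simple_graph G"
    and drawing: "plane_drawing G pos crv"
    and r_pos: "0 < r"
    and verts_apart: "v \<in> verts G \<Longrightarrow> w \<in> verts G \<Longrightarrow> v \<noteq> w \<Longrightarrow> 2 * r < dist (pos v) (pos w)"
    and edge_avoids: "v \<in> verts G \<Longrightarrow> e \<in> edges G \<Longrightarrow> v \<notin> e \<Longrightarrow>
      cball (pos v) r \<inter> path_image (crv e) = {}"
    and tip_dist: "e \<in> edges G \<Longrightarrow> v \<in> e \<Longrightarrow> dist (pos v) (tip v e) = r"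
    and spoke: "e \<in> edges G \<Longrightarrow> v \<in> e \<Longrightarrow>
      path_image (crv e) \<inter> cball (pos v) r = closed_segment (pos v) (tip v e)"

lemma simple_graph_finite_edges: "simple_graph G \<Longrightarrow> finite (edges G)"
  unfolding simple_graph_def by (metis Pow_iff finite_Pow_iff finite_subset subsetI)

lemma exists_spoke_radius:
  assumes G: "simple_graph G" and D: "plane_drawing G pos crv"
  shows "\<exists>r>0. (\<forall>v\<in>verts G. \<forall>w\<in>verts G. v \<noteq> w \<longrightarrow> 2 * r < dist (pos v) (pos w)) \<and>
    (\<forall>v\<in>verts G. \<forall>e\<in>edges G. v \<notin> e \<longrightarrow> cball (pos v) r \<inter> path_image (crv e) = {})"
proof -
  have fin: "finite (verts G)" "finite (edges G)"
    using G simple_graph_finite_edges by (auto simp: simple_graph_def)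
  have 1: "\<forall>\<^sub>F r in at_right 0. v \<noteq> w \<longrightarrow> 2 * r < dist (pos v) (pos w)"
    if "v \<in> verts G" "w \<in> verts G" for v w
  proof (cases "v = w")
    case False
    then have "0 < dist (pos v) (pos w)"
      using D that by (auto simp: plane_drawing_def inj_on_def)
    then show ?thesis
      unfolding eventually_at_right_field by (intro exI[of _ "dist (pos v) (pos w) / 2"]) auto
  qed auto
  have 2: "\<forall>\<^sub>F r in at_right 0. v \<notin> e \<longrightarrow> cball (pos v) r \<inter> path_image (crv e) = {}"
    if "v \<in> verts G" "e \<in> edges G" for v e
  proof (cases "v \<in> e")
    case False
    have sub: "e \<subseteq> verts G" using G that by (auto simp: simple_graph_def)
    have "path_image (crv e) \<inter> pos ` verts G = pos ` e" "arc (crv e)"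
      using D that by (auto simp: plane_drawing_def)
    moreover have "pos v \<notin> pos ` e"
      using D that sub False by (auto simp: plane_drawing_def inj_on_def)
    ultimately have "pos v \<in> - path_image (crv e)" "open (- path_image (crv e))"
      using that by (auto simp: closed_arc_image)
    then obtain d where "d > 0" "cball (pos v) d \<subseteq> - path_image (crv e)"
      by (meson open_contains_cball)
    then show ?thesis
      unfolding eventually_at_right_field by (intro exI[of _ d]) (auto simp: subset_iff)
  qed auto
  have "\<forall>\<^sub>F r in at_right (0::real). 0 < r \<and>
     (\<forall>v\<in>verts G. \<forall>w\<in>verts G. v \<noteq> w \<longrightarrow> 2 * r < dist (pos v) (pos w)) \<and>
     (\<forall>v\<in>verts G. \<forall>e\<in>edges G. v \<notin> e \<longrightarrow> cball (pos v) r \<inter> path_image (crv e) = {})"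
    apply (intro eventually_conj eventually_at_right_less)
    subgoal using fin(1) 1 by (intro eventually_ball_finite ballI) blast+
    subgoal using fin 2 by (intro eventually_ball_finite ballI) blast+
    done
  then show ?thesis
    using eventually_happens'[OF trivial_limit_at_right_real[of "0::real"]] by simp
qed

text \<open>All ends are straightened at once, with one radius. Different edges leave the disc of a common
vertex in different points, because the original arcs meet in vertices only; so their new radii
share only the centre, and nothing else can meet inside a disc.\<close>

lemma exists_spoked_drawing:
  assumes G: "simple_graph G" and D: "plane_drawing G pos crv"
  shows "\<exists>crv' r tip. spoked_drawing G pos crv' r tip"
proof -
  obtain r where r0: "r > 0"
      "\<forall>v\<in>verts G. \<forall>w\<in>verts G. v \<noteq> w \<longrightarrow> 2 * r < dist (pos v) (pos w)"
      "\<forall>v\<in>verts G. \<forall>e\<in>edges G. v \<notin> e \<longrightarrow> cball (pos v) r \<inter> path_image (crv e) = {}"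
    using exists_spoke_radius[OF G D] by (elim exE conjE)
  have r: "r > 0"
      "\<And>v w. v \<in> verts G \<Longrightarrow> w \<in> verts G \<Longrightarrow> v \<noteq> w \<Longrightarrow> 2 * r < dist (pos v) (pos w)"
      "\<And>v e. v \<in> verts G \<Longrightarrow> e \<in> edges G \<Longrightarrow> v \<notin> e \<Longrightarrow> cball (pos v) r \<inter> path_image (crv e) = {}"
    using r0 by simp_all
  have sub: "e \<subseteq> verts G" "card e = 2" if "e \<in> edges G" for e
    using G that by (auto simp: simple_graph_def)
  have inj: "inj_on pos (verts G)" using D by (simp add: plane_drawing_def)
  have D1: "arc (crv e)" "{pathstart (crv e), pathfinish (crv e)} = pos ` e"
      "path_image (crv e) \<inter> pos ` verts G = pos ` e" if "e \<in> edges G" for e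
    using D that by (auto simp: plane_drawing_def)
  have D2: "path_image (crv e) \<inter> path_image (crv e') = pos ` (e \<inter> e')"
    if "e \<in> edges G" "e' \<in> edges G" "e \<noteq> e'" for e e'
    using D that by (auto simp: plane_drawing_def)
  have "\<exists>h t. arc h \<and> {pathstart h, pathfinish h} = pos ` e \<and>
      (\<forall>v\<in>e. t v \<in> path_image (crv e) \<and> dist (pos v) (t v) = r \<and>
         path_image h \<inter> cball (pos v) r = closed_segment (pos v) (t v)) \<and>
      path_image h \<subseteq> path_image (crv e) \<union> (\<Union>v\<in>e. cball (pos v) r)"
    if e: "e \<in> edges G" for e
  proof -
    obtain a where a: "a \<in> e" "pathstart (crv e) = pos a" using D1[OF e] by (metis imageE insertI1)
    obtain b where b: "b \<in> e" "pathfinish (crv e) = pos b"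
      using D1[OF e] by (metis imageE insertI1 insert_commute)
    have "pos a \<noteq> pos b" using D1(1)[OF e] a b by (metis arc_distinct_ends)
    then have ab: "a \<noteq> b" by auto
    then have eab: "e = {a, b}" using sub[OF e] a b
      by (metis card_2_iff doubleton_eq_iff insertE singletonD)
    have far: "2 * r < dist (pathstart (crv e)) (pathfinish (crv e))"
      using r(2)[of a b] a b ab sub[OF e] by auto
    obtain h y z where h: "arc h" "pathstart h = pos a" "pathfinish h = pos b"
      "y \<in> path_image (crv e)" "dist (pos a) y = r"
      "z \<in> path_image (crv e)" "dist (pos b) z = r"
      "path_image h \<inter> cball (pos a) r = closed_segment (pos a) y"
      "path_image h \<inter> cball (pos b) r = closed_segment (pos b) z"
      "path_image h \<subseteq> path_image (crv e) \<union> cball (pos a) r \<union> cball (pos b) r"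
      by (rule straighten_arc_ends[OF D1(1)[OF e] r(1) far, unfolded a(2) b(2)])
    show ?thesis
      using h ab by (intro exI[of _ h] exI[of _ "\<lambda>v. if v = a then y else z"]) (auto simp: eab)
  qed
  then obtain h tip where h0: "\<forall>e\<in>edges G. arc (h e) \<and> {pathstart (h e), pathfinish (h e)} = pos ` e \<and>
      (\<forall>v\<in>e. tip e v \<in> path_image (crv e) \<and> dist (pos v) (tip e v) = r \<and>
         path_image (h e) \<inter> cball (pos v) r = closed_segment (pos v) (tip e v)) \<and>
      path_image (h e) \<subseteq> path_image (crv e) \<union> (\<Union>v\<in>e. cball (pos v) r)"
    by metis
  have h1: "arc (h e)" "{pathstart (h e), pathfinish (h e)} = pos ` e" if "e \<in> edges G" for e
    using h0 that by auto
  have h2: "tip e v \<in> path_image (crv e)" "dist (pos v) (tip e v) = r"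
         "path_image (h e) \<inter> cball (pos v) r = closed_segment (pos v) (tip e v)"
    if "e \<in> edges G" "v \<in> e" for e v
    using h0 that by auto
  have h3: "p \<in> path_image (crv e) \<or> (\<exists>v\<in>e. p \<in> cball (pos v) r)"
    if "e \<in> edges G" "p \<in> path_image (h e)" for e p
    using h0 that by blast
  have discs: "v = w" if "v \<in> verts G" "w \<in> verts G" "p \<in> cball (pos v) r" "p \<in> cball (pos w) r" for v w p
    using r(2)[of v w] that dist_triangle[of "pos v" "pos w" p] by (force simp: dist_commute)
  have avoid: "cball (pos v) r \<inter> path_image (h e) = {}"
    if "v \<in> verts G" "e \<in> edges G" "v \<notin> e" for v e
    using r(3)[OF that] h3[OF that(2)] discs[OF that(1)] sub[OF that(2)] that(3) by blast
  have hends: "pos ` e \<subseteq> path_image (h e)" if "e \<in> edges G" for e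
    using h1(2)[OF that] by (metis insert_subset pathfinish_in_path_image pathstart_in_path_image empty_subsetI)
  have "plane_drawing G pos h"
    unfolding plane_drawing_def
  proof (intro conjI ballI impI)
    fix e assume e: "e \<in> edges G"
    show "path_image (h e) \<inter> pos ` verts G = pos ` e"
    proof
      show "pos ` e \<subseteq> path_image (h e) \<inter> pos ` verts G" using hends[OF e] sub[OF e] by auto
      show "path_image (h e) \<inter> pos ` verts G \<subseteq> pos ` e"
      proof
        fix p assume "p \<in> path_image (h e) \<inter> pos ` verts G"
        then obtain v where v: "v \<in> verts G" "p = pos v" "pos v \<in> path_image (h e)" by auto
        moreover have "pos v \<in> cball (pos v) r" using r(1) by simp
        ultimately have "v \<in> e" using avoid[OF v(1) e] by blast
        then show "p \<in> pos ` e" using v(2) by simp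
      qed
    qed
    fix e' assume e': "e' \<in> edges G" and ne: "e \<noteq> e'"
    show "path_image (h e) \<inter> path_image (h e') = pos ` (e \<inter> e')"
    proof
      show "pos ` (e \<inter> e') \<subseteq> path_image (h e) \<inter> path_image (h e')"
        using hends[OF e] hends[OF e'] by auto
      show "path_image (h e) \<inter> path_image (h e') \<subseteq> pos ` (e \<inter> e')"
      proof
        fix p assume p: "p \<in> path_image (h e) \<inter> path_image (h e')"
        show "p \<in> pos ` (e \<inter> e')"
        proof (cases "\<exists>v\<in>verts G. p \<in> cball (pos v) r")
          case True
          then obtain v where v: "v \<in> verts G" "p \<in> cball (pos v) r" by blast
          have ve: "v \<in> e" "v \<in> e'" using avoid[OF v(1) e] avoid[OF v(1) e'] v(2) p by blast+
          have "tip e v \<noteq> tip e' v"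
          proof
            assume "tip e v = tip e' v"
            then have "tip e v \<in> pos ` (e \<inter> e')"
              using D2[OF e e' ne] h2(1)[OF e ve(1)] h2(1)[OF e' ve(2)] by auto
            then obtain w where w: "w \<in> verts G" "tip e v = pos w" using sub[OF e] by auto
            then have "dist (pos v) (pos w) = r" using h2(2)[OF e ve(1)] by simp
            then show False using r(1) r(2)[OF v(1) w(1)] by (cases "v = w") auto
          qed
          then have "closed_segment (pos v) (tip e v) \<inter> closed_segment (pos v) (tip e' v) \<subseteq> {pos v}"
            using h2(2)[OF e ve(1)] h2(2)[OF e' ve(2)] r(1)
            by (intro closed_segments_same_length_Int) auto
          then have "p = pos v"
            using p v(2) h2(3)[OF e ve(1)] h2(3)[OF e' ve(2)] by blast
          then show ?thesis using ve by auto
        next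
          case False
          then show ?thesis
            using p h3[OF e, of p] h3[OF e', of p] D2[OF e e' ne] sub[OF e] sub[OF e'] by blast
        qed
      qed
    qed
  qed (use h1 inj in auto)
  then have "spoked_drawing G pos h r (\<lambda>v e. tip e v)"
    by unfold_locales (use G r avoid h2 in auto)
  then show ?thesis by blast
qed

section \<open>Faces of a spoked drawing\<close>

context spoked_drawing
begin

lemma inj_pos: "inj_on pos (verts G)"
  using drawing by (simp add: plane_drawing_def)

lemma edge_sub: "e \<in> edges G \<Longrightarrow> e \<subseteq> verts G" and edge_card: "e \<in> edges G \<Longrightarrow> card e = 2"
  using simple by (auto simp: simple_graph_def)

lemma edge_arc: "e \<in> edges G \<Longrightarrow> arc (crv e)"
  and edge_ends: "e \<in> edges G \<Longrightarrow> {pathstart (crv e), pathfinish (crv e)} = pos ` e"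
  and edge_verts: "e \<in> edges G \<Longrightarrow> path_image (crv e) \<inter> pos ` verts G = pos ` e"
  using drawing by (simp_all add: plane_drawing_def)

lemma edge_edge: "e \<in> edges G \<Longrightarrow> e' \<in> edges G \<Longrightarrow> e \<noteq> e' \<Longrightarrow>
    path_image (crv e) \<inter> path_image (crv e') = pos ` (e \<inter> e')"
  using drawing by (simp add: plane_drawing_def)

abbreviation D where "D \<equiv> drawn G pos crv"

lemma closed_drawn: "closed D"
proof -
  have "finite (verts G)" using simple by (simp add: simple_graph_def)
  then show ?thesis
    unfolding drawn_def using simple_graph_finite_edges[OF simple]
    by (intro closed_Un closed_UN) (auto intro: finite_imp_closed closed_arc_image edge_arc)
qed

lemma edge_drawn: "e \<in> edges G \<Longrightarrow> path_image (crv e) \<subseteq> D"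
  by (auto simp: drawn_def)

lemma drawn_near_vertex:
  assumes v: "v \<in> verts G" and z: "z \<in> D" "dist (pos v) z \<le> r" "z \<noteq> pos v"
  shows "\<exists>e\<in>edges G. v \<in> e \<and> (\<exists>s>0. s \<le> 1 \<and> z = pos v + s *\<^sub>R (tip v e - pos v))"
proof -
  have "z \<notin> pos ` verts G"
  proof
    assume "z \<in> pos ` verts G"
    then obtain w where "w \<in> verts G" "z = pos w" by auto
    then show False using verts_apart[OF v, of w] z r_pos by auto
  qed
  then obtain e where e: "e \<in> edges G" "z \<in> path_image (crv e)"
    using z(1) by (auto simp: drawn_def)
  have zc: "z \<in> cball (pos v) r" using z(2) by simp
  have ve: "v \<in> e" using edge_avoids[OF v e(1)] e(2) zc by blast
  have "z \<in> closed_segment (pos v) (tip v e)"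
    using spoke[OF e(1) ve] e(2) zc by blast
  then obtain s where s: "0 \<le> s" "s \<le> 1" "z = (1 - s) *\<^sub>R pos v + s *\<^sub>R tip v e"
    by (auto simp: in_segment)
  then have zs: "z = pos v + s *\<^sub>R (tip v e - pos v)" by (simp add: algebra_simps)
  then have "s \<noteq> 0" using z(3) by auto
  then show ?thesis using s zs e(1) ve by (intro bexI[of _ e] conjI exI[of _ s]) auto
qed

lemma spoke_point:
  assumes e: "e \<in> edges G" "v \<in> e" and s: "0 \<le> s" "s \<le> 1"
  shows "pos v + s *\<^sub>R (tip v e - pos v) \<in> path_image (crv e)"
proof -
  have "pos v + s *\<^sub>R (tip v e - pos v) \<in> closed_segment (pos v) (tip v e)"
    using s unfolding in_segment by (intro exI[of _ s]) (simp add: algebra_simps)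
  then show ?thesis using spoke[OF e] by blast
qed

text \<open>The drawing inside a disc consists of whole spokes, so with a point outside the drawing the entire
radius towards the centre is outside.\<close>

lemma ray_avoids_drawing:
  assumes v: "v \<in> verts G" and z: "z \<notin> D" "dist (pos v) z \<le> r" and t: "0 < t" "t \<le> 1"
  shows "pos v + t *\<^sub>R (z - pos v) \<notin> D"
proof
  let ?w = "pos v + t *\<^sub>R (z - pos v)"
  assume w: "?w \<in> D"
  have zv: "z \<noteq> pos v" using z(1) v by (auto simp: drawn_def)
  have "dist (pos v) ?w = t * dist (pos v) z"
    using t by (simp add: dist_norm norm_minus_commute)
  then have "dist (pos v) ?w \<le> r"
    using t z(2) mult_right_mono[of t 1 "dist (pos v) z"] by simp
  then obtain e s where e: "e \<in> edges G" "v \<in> e" and s: "s > 0" "?w = pos v + s *\<^sub>R (tip v e - pos v)"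
    using drawn_near_vertex[OF v w] t zv by auto
  have "t *\<^sub>R (z - pos v) = s *\<^sub>R (tip v e - pos v)" using s(2) by (rule add_left_imp_eq)
  then have "(1 / t) *\<^sub>R (t *\<^sub>R (z - pos v)) = (1 / t) *\<^sub>R (s *\<^sub>R (tip v e - pos v))"
    by (rule arg_cong)
  then have zs: "z - pos v = (s / t) *\<^sub>R (tip v e - pos v)" using t by simp
  then have "dist (pos v) z = (s / t) * dist (pos v) (tip v e)"
    using s t by (simp add: dist_norm norm_minus_commute)
  then have "(s / t) * r \<le> r" using tip_dist[OF e] z(2) by simp
  then have "s / t \<le> 1" using r_pos by (metis mult.left_neutral mult_right_le_imp_le)
  then have "pos v + (s / t) *\<^sub>R (tip v e - pos v) \<in> path_image (crv e)"
    using s t by (intro spoke_point[OF e]) auto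
  then have "z \<in> path_image (crv e)" using zs by (metis add_diff_cancel_left' diff_add_cancel add.commute)
  then show False using z(1) edge_drawn[OF e(1)] by blast
qed

lemma accessible_from_face:
  assumes v: "v \<in> verts G" and F: "F \<in> components (- D)" and cl: "pos v \<in> closure F"
  shows "\<exists>z\<in>F. closed_segment (pos v) z \<subseteq> insert (pos v) F"
proof -
  obtain z where z: "z \<in> F" "dist z (pos v) < r"
    using cl r_pos by (meson closure_approachable)
  have zD: "z \<notin> D" using in_components_subset[OF F] z(1) by auto
  let ?S = "(\<lambda>t. pos v + t *\<^sub>R (z - pos v)) ` {0<..1}"
  have "connected ?S"
    by (intro connected_continuous_image continuous_intros) auto
  moreover have "?S \<subseteq> - D"
    using ray_avoids_drawing[OF v zD] z(2) by (auto simp: dist_commute)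
  moreover have "z \<in> ?S" by (rule image_eqI[of _ _ 1]) auto
  ultimately have S: "?S \<subseteq> F" using components_maximal[OF F] z(1) by blast
  have "closed_segment (pos v) z \<subseteq> insert (pos v) F"
  proof
    fix x assume "x \<in> closed_segment (pos v) z"
    then obtain t where t: "0 \<le> t" "t \<le> 1" "x = (1 - t) *\<^sub>R pos v + t *\<^sub>R z"
      by (auto simp: in_segment)
    then have x: "x = pos v + t *\<^sub>R (z - pos v)" by (simp add: algebra_simps)
    show "x \<in> insert (pos v) F"
    proof (cases "t = 0")
      case False
      then have "x \<in> ?S" using t(1,2) x by (intro image_eqI[of _ _ t]) auto
      then show ?thesis using S by blast
    qed (use x in simp)
  qed
  then show ?thesis using z(1) by blast
qed

text \<open>A face and two vertices in its closure form a path connected set, since the vertices are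
accessible along segments; an arc between the vertices in this set can serve as a new edge.\<close>

lemma arc_through_face:
  assumes uv: "u \<in> verts G" "v \<in> verts G" "u \<noteq> v" and F: "F \<in> components (- D)"
    and cl: "pos u \<in> closure F" "pos v \<in> closure F"
  shows "\<exists>q. arc q \<and> pathstart q = pos u \<and> pathfinish q = pos v \<and>
    path_image q \<subseteq> F \<union> {pos u, pos v}"
proof -
  obtain z where z: "z \<in> F" "closed_segment (pos u) z \<subseteq> insert (pos u) F"
    using accessible_from_face[OF uv(1) F cl(1)] by blast
  obtain z' where z': "z' \<in> F" "closed_segment (pos v) z' \<subseteq> insert (pos v) F"
    using accessible_from_face[OF uv(2) F cl(2)] by blast
  have "open F" using open_components[OF _ F] closed_drawn by auto
  then have "path_connected F"
    using in_components_connected[OF F] by (simp add: connected_open_path_connected)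
  then obtain p where p: "path p" "path_image p \<subseteq> F" "pathstart p = z" "pathfinish p = z'"
    using z(1) z'(1) unfolding path_connected_def by blast
  let ?k = "linepath (pos u) z +++ (p +++ linepath z' (pos v))"
  have k: "path ?k" "pathstart ?k = pos u" "pathfinish ?k = pos v" using p by auto
  have "closed_segment z' (pos v) \<subseteq> insert (pos v) F" using z'(2) by (simp add: closed_segment_commute)
  then have "path_image ?k \<subseteq> F \<union> {pos u, pos v}"
    using p z z' by (auto simp: path_image_join)
  moreover have "pos u \<noteq> pos v" using uv inj_pos by (auto simp: inj_on_def)
  ultimately show ?thesis using path_contains_arc[OF k] by (metis order_trans)
qed

lemma planar_add_edge:
  assumes uv: "u \<in> verts G" "v \<in> verts G" "u \<noteq> v" "{u, v} \<notin> edges G" and F: "F \<in> components (- D)"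
    and cl: "pos u \<in> closure F" "pos v \<in> closure F"
  shows "planar (add_edge G u v)"
proof -
  obtain q where q: "arc q" "pathstart q = pos u" "pathfinish q = pos v"
      "path_image q \<subseteq> F \<union> {pos u, pos v}"
    using arc_through_face[OF uv(1-3) F cl] by blast
  have qends: "pos u \<in> path_image q" "pos v \<in> path_image q"
    using q by (metis pathstart_in_path_image, metis pathfinish_in_path_image)
  have qD: "path_image q \<inter> D \<subseteq> {pos u, pos v}"
    using q(4) in_components_subset[OF F] by blast
  have qV: "path_image q \<inter> pos ` verts G = pos ` {u, v}"
    using qD qends uv by (auto simp: drawn_def)
  have qe: "path_image q \<inter> path_image (crv e) = pos ` ({u, v} \<inter> e)" if e: "e \<in> edges G" for e
  proof
    have "path_image (crv e) \<inter> pos ` verts G = pos ` e" using edge_verts[OF e] .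
    then show "pos ` ({u, v} \<inter> e) \<subseteq> path_image q \<inter> path_image (crv e)"
      using qends by auto
    show "path_image q \<inter> path_image (crv e) \<subseteq> pos ` ({u, v} \<inter> e)"
    proof
      fix x assume x: "x \<in> path_image q \<inter> path_image (crv e)"
      then have "x \<in> {pos u, pos v}" using qD edge_drawn[OF e] by blast
      then obtain w where w: "w \<in> {u, v}" "x = pos w" by blast
      then have "pos w \<in> pos ` e" using x edge_verts[OF e] uv by blast
      then have "w \<in> e" using w(1) uv edge_sub[OF e] inj_pos by (auto simp: inj_on_def)
      then show "x \<in> pos ` ({u, v} \<inter> e)" using w by auto
    qed
  qed
  let ?c = "crv({u, v} := q)"
  have c: "?c e = crv e" if "e \<in> edges G" for e using that uv(4) by auto
  have "plane_drawing (add_edge G u v) pos ?c"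
    unfolding plane_drawing_def
  proof (intro conjI ballI impI)
    show "inj_on pos (verts (add_edge G u v))" using inj_pos by (simp add: add_edge_def)
    fix e assume "e \<in> edges (add_edge G u v)"
    then have e: "e = {u, v} \<or> e \<in> edges G" by (auto simp: add_edge_def)
    show "arc (?c e)" using e q(1) c edge_arc by auto
    show "{pathstart (?c e), pathfinish (?c e)} = pos ` e" using e q(2,3) c edge_ends by auto
    show "path_image (?c e) \<inter> pos ` verts (add_edge G u v) = pos ` e"
    proof (cases "e = {u, v}")
      case True
      then show ?thesis using qV by (simp add: add_edge_def)
    next
      case False
      then show ?thesis using e edge_verts by (simp add: add_edge_def)
    qed
    fix e' assume "e' \<in> edges (add_edge G u v)" and ne: "e \<noteq> e'"
    then have e': "e' = {u, v} \<or> e' \<in> edges G" by (auto simp: add_edge_def)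
    show "path_image (?c e) \<inter> path_image (?c e') = pos ` (e \<inter> e')"
    proof (cases "e = {u, v}")
      case True
      then have "e' \<in> edges G" "e' \<noteq> {u, v}" using e' ne by auto
      then show ?thesis using True qe[of e'] by simp
    next
      case False
      then have eG: "e \<in> edges G" using e by auto
      show ?thesis
      proof (cases "e' = {u, v}")
        case True
        then show ?thesis using False qe[OF eG] by (simp add: Int_commute)
      next
        case False
        then show ?thesis using \<open>e \<noteq> {u, v}\<close> eG e' edge_edge[OF eG _ ne] by simp
      qed
    qed
  qed
  moreover have "simple_graph (add_edge G u v)"
    using simple uv by (auto simp: simple_graph_def add_edge_def)
  ultimately show ?thesis by (auto simp: planar_def)
qed

lemma edge_ends_in_closure:
  assumes e: "e \<in> edges G" and F: "F \<in> components (- D)" and x: "x \<in> path_image (crv e)" "x \<in> closure F"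
  shows "\<exists>v\<in>e. pos v \<in> closure F"
    and "x \<notin> pos ` e \<Longrightarrow> v \<in> e \<Longrightarrow> pos v \<in> closure F"
proof -
  define K where "K = pos ` verts G \<union> (\<Union>e'\<in>edges G - {e}. path_image (crv e'))"
  have KD: "K \<union> path_image (crv e) = D" using e by (auto simp: K_def drawn_def)
  have "finite (verts G)" using simple by (simp add: simple_graph_def)
  then have K: "closed K"
    unfolding K_def using simple_graph_finite_edges[OF simple]
    by (intro closed_Un closed_UN) (auto intro: finite_imp_closed closed_arc_image edge_arc)
  have gK: "path_image (crv e) \<inter> K \<subseteq> {pathstart (crv e), pathfinish (crv e)}"
    unfolding edge_ends[OF e]
  proof
    fix x assume x: "x \<in> path_image (crv e) \<inter> K"
    show "x \<in> pos ` e"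
    proof (cases "x \<in> pos ` verts G")
      case False
      then obtain e' where "e' \<in> edges G" "e' \<noteq> e" "x \<in> path_image (crv e')"
        using x by (auto simp: K_def)
      then show ?thesis using edge_edge[OF e, of e'] x by blast
    qed (use x edge_verts[OF e] in blast)
  qed
  have F': "F \<in> components (- (K \<union> path_image (crv e)))" using F KD by simp
  note * = ends_in_closure_component[OF edge_arc[OF e] K gK F' x]
  show "\<exists>v\<in>e. pos v \<in> closure F" using *(1) unfolding edge_ends[OF e] by blast
  show "pos v \<in> closure F" if "x \<notin> pos ` e" "v \<in> e"
  proof -
    have "x \<noteq> pathstart (crv e)" "x \<noteq> pathfinish (crv e)"
      using that(1) edge_ends[OF e] by auto
    then show ?thesis using *(2) that(2) unfolding edge_ends[OF e] by blast
  qed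
qed

lemma vertex_in_closure_of_part:
  assumes F: "F \<in> components (- D)"
    and x: "x \<in> pos ` A \<union> (\<Union>e\<in>{e\<in>edges G. e \<subseteq> A}. path_image (crv e))" "x \<in> closure F"
  shows "\<exists>v\<in>A. pos v \<in> closure F"
  using x edge_ends_in_closure(1)[OF _ F _ x(2)] by blast

text \<open>The drawings of the two parts are disjoint compact sets. The open segment between a closest pair
of points of these sets avoids both, hence lies in one face; each of the two points is a vertex
or lies on an edge, whose ends are then in the closure of that face as well.\<close>

lemma closest_parts_share_face:
  assumes AB: "A \<union> B = verts G" "A \<inter> B = {}" "A \<noteq> {}" "B \<noteq> {}"
    and split: "\<And>e. e \<in> edges G \<Longrightarrow> e \<subseteq> A \<or> e \<subseteq> B"
  shows "\<exists>F\<in>components (- D). (\<exists>u\<in>A. pos u \<in> closure F) \<and> (\<exists>v\<in>B. pos v \<in> closure F)"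
proof -
  define P where "P X = pos ` X \<union> (\<Union>e\<in>{e\<in>edges G. e \<subseteq> X}. path_image (crv e))" for X
  have fin: "finite (verts G)" using simple by (simp add: simple_graph_def)
  have cpt: "compact (P X)" if "X \<subseteq> verts G" for X
    unfolding P_def using simple_graph_finite_edges[OF simple] finite_subset[OF that fin]
    by (intro compact_Un compact_UN) (auto intro: finite_imp_compact compact_arc_image edge_arc)
  have D: "D = P A \<union> P B" unfolding P_def drawn_def using split AB(1) by blast
  have disj: "P A \<inter> P B = {}"
  proof -
    have 1: "pos a \<noteq> pos b" if "a \<in> A" "b \<in> B" for a b
      using that AB inj_pos by (auto simp: inj_on_def)
    have 2: "pos a \<notin> path_image (crv e)" if "a \<in> verts G" "e \<in> edges G" "a \<notin> e" for a e
      using edge_verts[OF that(2)] edge_sub[OF that(2)] that inj_pos by (auto simp: inj_on_def)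
    have 3: "path_image (crv e) \<inter> path_image (crv e') = {}"
      if "e \<in> edges G" "e' \<in> edges G" "e \<subseteq> A" "e' \<subseteq> B" for e e'
    proof -
      have "e \<inter> e' = {}" using that AB(2) by auto
      moreover have "e \<noteq> {}" using edge_card[OF that(1)] by auto
      ultimately show ?thesis using edge_edge[OF that(1,2)] by auto
    qed
    show ?thesis
    proof (rule ccontr)
      assume "P A \<inter> P B \<noteq> {}"
      then obtain x where x: "x \<in> P A" "x \<in> P B" by blast
      show False
        using x unfolding P_def
      proof (elim UnE)
        assume "x \<in> pos ` A" "x \<in> pos ` B" then show False using 1 by blast
      next
        assume "x \<in> pos ` A" "x \<in> (\<Union>e\<in>{e\<in>edges G. e \<subseteq> B}. path_image (crv e))"
        then show False using 2 AB by blast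
      next
        assume "x \<in> (\<Union>e\<in>{e\<in>edges G. e \<subseteq> A}. path_image (crv e))" "x \<in> pos ` B"
        then show False using 2 AB by blast
      next
        assume "x \<in> (\<Union>e\<in>{e\<in>edges G. e \<subseteq> A}. path_image (crv e))"
               "x \<in> (\<Union>e\<in>{e\<in>edges G. e \<subseteq> B}. path_image (crv e))"
        then show False using 3 by blast
      qed
    qed
  qed
  have "P A \<noteq> {}" "P B \<noteq> {}" using AB by (auto simp: P_def)
  then obtain x y where xy: "x \<in> P A" "y \<in> P B" "dist x y = setdist (P A) (P B)"
    using setdist_compact_closed[OF cpt[of A] compact_imp_closed[OF cpt[of B]]] AB(1) by blast
  have min: "dist x y \<le> dist p q" if "p \<in> P A" "q \<in> P B" for p q
    using setdist_le_dist[OF that] xy(3) by simp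
  have ne: "x \<noteq> y" using xy disj by blast
  have seg: "open_segment x y \<subseteq> - D"
  proof
    fix z assume z: "z \<in> open_segment x y"
    have "dist x z < dist x y" "dist z y < dist x y"
      using z dist_in_open_segment[OF z] by (auto simp: dist_commute)
    then have "z \<notin> P A" "z \<notin> P B" using min[of z y] min[of x z] xy by auto
    then show "z \<in> - D" by (simp add: D)
  qed
  have "midpoint x y \<in> open_segment x y" using ne by (simp add: midpoint_in_open_segment)
  then have "- D \<noteq> {}" using seg by blast
  then obtain F where F: "F \<in> components (- D)" "open_segment x y \<subseteq> F"
    using seg exists_component_superset[of "open_segment x y" "- D"] convex_connected[OF convex_open_segment]
    by blast
  have "closure (open_segment x y) \<subseteq> closure F" using F(2) by (rule closure_mono)
  then have "x \<in> closure F" "y \<in> closure F" using ne by (auto simp: closure_open_segment)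
  then have "\<exists>u\<in>A. pos u \<in> closure F" "\<exists>v\<in>B. pos v \<in> closure F"
    using vertex_in_closure_of_part[OF F(1), of x A] vertex_in_closure_of_part[OF F(1), of y B]
      xy(1,2) unfolding P_def by blast+
  then show ?thesis using F(1) by blast
qed

end

lemma cis_inj_2pi:
  assumes "cis s = cis t" "0 \<le> s" "s < 2 * pi" "0 \<le> t" "t < 2 * pi"
  shows "s = t"
  using Arg2pi_unique[of 1 s "cis s"] Arg2pi_unique[of 1 t "cis s"] assms
  by (simp add: cis_conv_exp)

context spoked_drawing
begin

definition spoke_angle :: "'a \<Rightarrow> 'a \<Rightarrow> real" where
  "spoke_angle v a = Arg2pi (tip v {v, a} - pos v)"

lemma spoke_angle_bounds: "0 \<le> spoke_angle v a" "spoke_angle v a < 2 * pi"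
  by (auto simp: spoke_angle_def Arg2pi_ge_0 Arg2pi_lt_2pi)

lemma tip_polar:
  assumes "a \<in> neighbours G v"
  shows "tip v {v, a} - pos v = of_real r * cis (spoke_angle v a)"
proof -
  have "norm (tip v {v, a} - pos v) = r"
    using tip_dist[of "{v, a}" v] assms by (simp add: neighbours_def dist_norm norm_minus_commute)
  then show ?thesis
    using Arg2pi_eq[of "tip v {v, a} - pos v"] by (simp add: spoke_angle_def cis_conv_exp)
qed

lemma neighbours_sub: "neighbours G v \<subseteq> verts G" and neighbours_irrefl: "v \<notin> neighbours G v"
  and neighbours_vert: "a \<in> neighbours G v \<Longrightarrow> v \<in> verts G"
  using edge_sub edge_card by (fastforce simp: neighbours_def)+

lemma inj_spoke_angle: "inj_on (spoke_angle v) (neighbours G v)"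
proof (rule inj_onI, rule ccontr)
  fix a b assume ab: "a \<in> neighbours G v" "b \<in> neighbours G v" "spoke_angle v a = spoke_angle v b" "a \<noteq> b"
  have e: "{v, a} \<in> edges G" "{v, b} \<in> edges G" using ab by (auto simp: neighbours_def)
  have ne: "{v, a} \<noteq> {v, b}" using ab neighbours_irrefl by (auto simp: doubleton_eq_iff)
  have "{v, a} \<inter> {v, b} = {v}" using ab by auto
  moreover have "tip v {v, a} = tip v {v, b}" 
    using tip_polar[OF ab(1)] tip_polar[OF ab(2)] ab(3) by (metis diff_add_cancel)
  moreover have "tip v {v, a} \<in> path_image (crv {v, a})" "tip v {v, b} \<in> path_image (crv {v, b})"
    using spoke_point[OF e(1), of v 1] spoke_point[OF e(2), of v 1] by auto
  ultimately have "tip v {v, a} = pos v" using edge_edge[OF e ne] by auto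
  then show False using tip_dist[OF e(1), of v] r_pos by auto
qed

lemma drawn_near_vertex_angle:
  assumes v: "v \<in> verts G" and z: "z \<in> D" "dist (pos v) z \<le> r" "z \<noteq> pos v"
  shows "\<exists>a\<in>neighbours G v. Arg2pi (z - pos v) = spoke_angle v a"
proof -
  obtain e s where e: "e \<in> edges G" "v \<in> e" "s > 0" "z = pos v + s *\<^sub>R (tip v e - pos v)"
    using drawn_near_vertex[OF v z] by blast
  obtain a where a: "e = {v, a}"
    using edge_card[OF e(1)] e(2) by (auto simp: card_2_iff insert_commute)
  have "z - pos v = of_real s * (tip v {v, a} - pos v)"
    using e(4) a by (simp add: scaleR_conv_of_real)
  then have "Arg2pi (z - pos v) = spoke_angle v a"
    using e(3) by (simp add: spoke_angle_def)
  then show ?thesis using e(1) a by (auto simp: neighbours_def)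
qed

text \<open>A sector between neighbouring spokes is connected and misses the drawing, so it lies in one face,
whose closure contains points of both spokes; by the closure property of faces along edges it
contains the other ends of the two edges too. Stated with real angles \<open>\<alpha> < \<beta>\<close> that need not be in
\<open>[0, 2\<pi>)\<close>, so that it also covers the sector across the zero direction.\<close>

lemma sector_face:
  assumes v: "v \<in> verts G" and ab: "a \<in> neighbours G v" "b \<in> neighbours G v"
    and lt: "\<alpha> < \<beta>" and cis: "cis \<alpha> = cis (spoke_angle v a)" "cis \<beta> = cis (spoke_angle v b)"
    and gap: "\<And>\<theta> c. \<alpha> < \<theta> \<Longrightarrow> \<theta> < \<beta> \<Longrightarrow> c \<in> neighbours G v \<Longrightarrow> cis \<theta> \<noteq> cis (spoke_angle v c)"
  shows "\<exists>F\<in>components (- D). pos a \<in> closure F \<and> pos b \<in> closure F"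
proof -
  define f where "f = (\<lambda>(\<rho>, \<theta>). pos v + of_real \<rho> * cis \<theta>)"
  define B where "B = {0<..<r} \<times> {\<alpha><..<\<beta>}"
  have cont: "continuous_on X f" for X
    unfolding f_def case_prod_unfold cis_conv_exp by (intro continuous_intros)
  have "connected (f ` B)"
    unfolding B_def by (intro connected_continuous_image cont connected_Times) auto
  moreover have fB: "f ` B \<subseteq> - D"
  proof clarify
    fix \<rho> \<theta> assume p: "(\<rho>, \<theta>) \<in> B" and inD: "f (\<rho>, \<theta>) \<in> D"
    have \<rho>: "0 < \<rho>" "\<rho> < r" and \<theta>: "\<alpha> < \<theta>" "\<theta> < \<beta>" using p by (auto simp: B_def)
    have "dist (pos v) (f (\<rho>, \<theta>)) = \<rho>" using \<rho> by (simp add: f_def dist_norm norm_mult)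
    then obtain c where c: "c \<in> neighbours G v" "Arg2pi (f (\<rho>, \<theta>) - pos v) = spoke_angle v c"
      using drawn_near_vertex_angle[OF v inD] \<rho> by fastforce
    have "Arg2pi (cis \<theta>) = spoke_angle v c" using c(2) \<rho> by (simp add: f_def)
    then have "cis \<theta> = cis (spoke_angle v c)"
      using Arg2pi_eq[of "cis \<theta>"] by (simp add: cis_conv_exp)
    then show False using gap[OF \<theta> c(1)] by blast
  qed
  moreover have "(r / 2, (\<alpha> + \<beta>) / 2) \<in> B" using r_pos lt by (auto simp: B_def field_simps)
  ultimately obtain F where F: "F \<in> components (- D)" "f ` B \<subseteq> F"
    using exists_component_superset[of "f ` B" "- D"] by blast
  have "f ` closure B \<subseteq> closure F"
    using F(2) closure_subset by (intro image_closure_subset cont) auto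
  moreover have "closure B = {0..r} \<times> {\<alpha>..\<beta>}" using lt r_pos by (simp add: B_def closure_Times)
  ultimately have cl: "f (r / 2, \<theta>) \<in> closure F" if "\<alpha> \<le> \<theta>" "\<theta> \<le> \<beta>" for \<theta>
    using that r_pos by force
  have "pos c \<in> closure F" if c: "c \<in> neighbours G v" and \<theta>: "\<alpha> \<le> \<theta>" "\<theta> \<le> \<beta>" "cis \<theta> = cis (spoke_angle v c)" for c \<theta>
  proof -
    have e: "{v, c} \<in> edges G" using c by (simp add: neighbours_def)
    \<comment> \<open>The midpoint of the spoke: an interior point of the edge in the closure of the sector.\<close>
    let ?x = "f (r / 2, \<theta>)"
    have x: "?x = pos v + (1 / 2) *\<^sub>R (tip v {v, c} - pos v)"
      using tip_polar[OF c] \<theta>(3) by (simp add: f_def scaleR_conv_of_real)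
    have "?x \<in> path_image (crv {v, c})" unfolding x using e by (intro spoke_point) auto
    moreover have "?x \<notin> pos ` {v, c}"
    proof
      assume "?x \<in> pos ` {v, c}"
      then obtain w where w: "w \<in> {v, c}" "?x = pos w" by blast
      have "dist (pos v) ?x = r / 2" using r_pos by (simp add: f_def dist_norm norm_mult)
      moreover have "w \<in> verts G" using w(1) edge_sub[OF e] by blast
      ultimately show False using w(2) verts_apart[OF v, of w] r_pos by (cases "w = v") auto
    qed
    ultimately show ?thesis using edge_ends_in_closure(2)[OF e F(1) _ cl[OF \<theta>(1,2)]] by auto
  qed
  then show ?thesis using F(1) ab lt cis by (meson order_refl less_imp_le)
qed

lemma consecutive_neighbours_share_face:
  "\<exists>xs. distinct xs \<and> set xs = neighbours G v \<and>
    (\<forall>i<length xs. \<exists>F\<in>components (- D).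
       pos (xs ! i) \<in> closure F \<and> pos (xs ! (Suc i mod length xs)) \<in> closure F)"
proof -
  have "finite (neighbours G v)"
    using neighbours_sub simple by (auto simp: simple_graph_def intro: finite_subset)
  then obtain ys where ys: "distinct ys" "set ys = neighbours G v"
    using finite_distinct_list by blast
  define xs where "xs = sort_key (spoke_angle v) ys"
  define \<theta> where "\<theta> i = spoke_angle v (xs ! i)" for i
  let ?n = "length xs"
  have xs: "distinct xs" "set xs = neighbours G v" "sorted (map (spoke_angle v) xs)"
    using ys by (auto simp: xs_def)
  have mem: "xs ! i \<in> neighbours G v" if "i < ?n" for i using that xs(2) nth_mem by blast
  have mono: "\<theta> i \<le> \<theta> j" if "i \<le> j" "j < ?n" for i j
    using sorted_nth_mono[OF xs(3), of i j] that by (simp add: \<theta>_def)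
  have strict: "\<theta> i < \<theta> j" if "i < j" "j < ?n" for i j
  proof -
    have "xs ! i \<noteq> xs ! j" using xs(1) that by (auto simp: nth_eq_iff_index_eq)
    then have "\<theta> i \<noteq> \<theta> j"
      using inj_onD[OF inj_spoke_angle, of v "xs ! i" "xs ! j"] mem that by (auto simp: \<theta>_def)
    then show ?thesis using mono[of i j] that by auto
  qed
  have bounds: "0 \<le> \<theta> i" "\<theta> i < 2 * pi" for i by (auto simp: \<theta>_def spoke_angle_bounds)
  have idx: "\<exists>j<?n. c = xs ! j" if "c \<in> neighbours G v" for c
    using that xs(2) by (metis in_set_conv_nth)
  have "\<exists>F\<in>components (- D). pos (xs ! i) \<in> closure F \<and> pos (xs ! (Suc i mod ?n)) \<in> closure F"
    if i: "i < ?n" for i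
  proof (cases "Suc i < ?n")
    case True
    show ?thesis
    proof (rule sector_face[of v _ _ "\<theta> i" "\<theta> (Suc i)"])
      show "\<theta> i < \<theta> (Suc i)" using strict True by auto
      fix t c assume t: "\<theta> i < t" "t < \<theta> (Suc i)" and c: "c \<in> neighbours G v"
      obtain j where j: "j < ?n" "c = xs ! j" using idx[OF c] by blast
      show "cis t \<noteq> cis (spoke_angle v c)"
      proof
        assume "cis t = cis (spoke_angle v c)"
        then have "t = \<theta> j"
          using j bounds[of i] bounds[of "Suc i"] bounds[of j] t by (intro cis_inj_2pi) (auto simp: \<theta>_def)
        then show False using t mono[of j i] mono[of "Suc i" j] i j by (cases "j \<le> i") auto
      qed
    qed (use mem neighbours_vert i True in \<open>auto simp: \<theta>_def\<close>)
  next
    case False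
    then have i': "Suc i = ?n" using i by simp
    have first: "xs ! 0 \<in> neighbours G v" by (rule mem) (use i in linarith)
    \<comment> \<open>The gap after the last spoke ends one full turn beyond the first one.\<close>
    show ?thesis
    proof (rule sector_face[of v _ _ "\<theta> i" "\<theta> 0 + 2 * pi"])
      show "\<theta> i < \<theta> 0 + 2 * pi" using bounds[of i] bounds[of 0] by auto
      show "cis (\<theta> 0 + 2 * pi) = cis (spoke_angle v (xs ! (Suc i mod ?n)))"
        by (simp add: i' \<theta>_def flip: cis_mult)
      fix t c assume t: "\<theta> i < t" "t < \<theta> 0 + 2 * pi" and c: "c \<in> neighbours G v"
      obtain j where j: "j < ?n" "c = xs ! j" using idx[OF c] by blast
      show "cis t \<noteq> cis (spoke_angle v c)"
      proof
        assume eq: "cis t = cis (spoke_angle v c)"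
        show False
        proof (cases "t < 2 * pi")
          case True
          then have "t = \<theta> j"
            using eq j bounds[of i] bounds[of j] t by (intro cis_inj_2pi) (auto simp: \<theta>_def)
          then show False using t mono[of j i] i' j by auto
        next
          case False
          have "cis (t - 2 * pi) = cis (spoke_angle v c)"
            using eq by (simp add: cis_divide[symmetric])
          then have "t - 2 * pi = \<theta> j"
            using False j bounds[of 0] bounds[of j] t by (intro cis_inj_2pi) (auto simp: \<theta>_def)
          then show False using t mono[of 0 j] j by auto
        qed
      qed
    qed (use mem[OF i] first i' neighbours_vert[OF mem[OF i]] in \<open>auto simp: \<theta>_def\<close>)
  qed
  then show ?thesis using xs by blast
qed

end

section \<open>Links and connectivity of maximal planar graphs\<close>

lemma maximal_planar_spoked:
  assumes "maximal_planar G"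
  obtains pos crv r tip where "spoked_drawing G pos crv r tip"
  using assms exists_spoked_drawing unfolding maximal_planar_def planar_def by meson

lemma maximal_planar_simple: "maximal_planar G \<Longrightarrow> simple_graph G"
  by (simp add: maximal_planar_def planar_def)

lemma (in spoked_drawing) maximal_planar_face_adjacent:
  assumes "maximal_planar G" "F \<in> components (- D)" "u \<in> verts G" "v \<in> verts G" "u \<noteq> v"
    "pos u \<in> closure F" "pos v \<in> closure F"
  shows "{u, v} \<in> edges G"
  using assms planar_add_edge unfolding maximal_planar_def by blast

text \<open>Connectedness, in the form used later: a nonempty set of vertices that is closed under taking
neighbours is everything, as otherwise the set and its complement share a face and could be joined by
an edge.\<close>

lemma maximal_planar_connected:
  assumes G: "maximal_planar G" and C: "C \<subseteq> verts G" "C \<noteq> {}"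
    and closed: "\<And>v. v \<in> C \<Longrightarrow> neighbours G v \<subseteq> C"
  shows "C = verts G"
proof (rule ccontr)
  assume ne: "C \<noteq> verts G"
  obtain pos crv r tip where "spoked_drawing G pos crv r tip" using maximal_planar_spoked[OF G] .
  then interpret spoked_drawing G pos crv r tip .
  have split: "e \<subseteq> C \<or> e \<subseteq> verts G - C" if e: "e \<in> edges G" for e
  proof -
    obtain a b where ab: "e = {a, b}" using edge_card[OF e] by (auto simp: card_2_iff)
    have "a \<in> C \<longleftrightarrow> b \<in> C"
    proof -
      have "b \<in> neighbours G a" "a \<in> neighbours G b"
        using e ab by (auto simp: neighbours_def insert_commute)
      then show ?thesis using closed by blast
    qed
    then show ?thesis using edge_sub[OF e] ab by auto
  qed
  obtain F u v where "F \<in> components (- D)" "u \<in> C" "v \<in> verts G - C"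
      "pos u \<in> closure F" "pos v \<in> closure F"
    using closest_parts_share_face[of C "verts G - C"] split C ne by blast
  then have "{u, v} \<in> edges G" using maximal_planar_face_adjacent[OF G] C by blast
  then show False using closed[of u] \<open>u \<in> C\<close> \<open>v \<in> verts G - C\<close> by (auto simp: neighbours_def)
qed

text \<open>The neighbours of a vertex, listed by angle, form a cycle: consecutive neighbours share a face,
hence are adjacent. With a single neighbour the cyclic successor of the only entry is
that entry itself, which explains the guard on the length.\<close>

lemma maximal_planar_link:
  assumes G: "maximal_planar G"
  shows "\<exists>xs. distinct xs \<and> set xs = neighbours G v \<and>
    (2 \<le> length xs \<longrightarrow> (\<forall>i<length xs. {xs ! i, xs ! (Suc i mod length xs)} \<in> edges G))"
proof -
  obtain pos crv r tip where "spoked_drawing G pos crv r tip" using maximal_planar_spoked[OF G] .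
  then interpret spoked_drawing G pos crv r tip .
  obtain xs where xs: "distinct xs" "set xs = neighbours G v"
    "\<And>i. i < length xs \<Longrightarrow> \<exists>F\<in>components (- D).
       pos (xs ! i) \<in> closure F \<and> pos (xs ! (Suc i mod length xs)) \<in> closure F"
    using consecutive_neighbours_share_face by blast
  have "{xs ! i, xs ! (Suc i mod length xs)} \<in> edges G" if n: "2 \<le> length xs" and i: "i < length xs" for i
  proof -
    obtain F where F: "F \<in> components (- D)" "pos (xs ! i) \<in> closure F"
        "pos (xs ! (Suc i mod length xs)) \<in> closure F" using xs(3)[OF i] by blast
    have j: "Suc i mod length xs < length xs" using i by (intro mod_less_divisor) linarith
    have "Suc i mod length xs \<noteq> i" using i n by (cases "Suc i = length xs") auto
    then have "xs ! i \<noteq> xs ! (Suc i mod length xs)"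
      using xs(1) i j by (metis nth_eq_iff_index_eq)
    moreover have "xs ! i \<in> verts G" "xs ! (Suc i mod length xs) \<in> verts G"
      using nth_mem[OF i] nth_mem[OF j] xs(2) neighbours_sub by auto
    ultimately show ?thesis using maximal_planar_face_adjacent[OF G F(1)] F by blast
  qed
  then show ?thesis using xs(1,2) by blast
qed

section \<open>A vertex of degree at least five\<close>

lemma neighbours_commute: "a \<in> neighbours G b \<longleftrightarrow> b \<in> neighbours G a"
  by (simp add: neighbours_def insert_commute)

lemma finite_neighbours: "simple_graph G \<Longrightarrow> finite (neighbours G v)"
  and neighbours_subset_verts: "simple_graph G \<Longrightarrow> neighbours G v \<subseteq> verts G"
  and not_own_neighbour: "simple_graph G \<Longrightarrow> v \<notin> neighbours G v"
proof -
  assume G: "simple_graph G"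
  show sub: "neighbours G v \<subseteq> verts G" using G by (auto simp: simple_graph_def neighbours_def)
  then show "finite (neighbours G v)" using G by (auto simp: simple_graph_def intro: finite_subset)
  show "v \<notin> neighbours G v" using G by (force simp: simple_graph_def neighbours_def)
qed

lemma link_min_degree:
  assumes G: "maximal_planar G" and v: "3 \<le> card (neighbours G v)" and a: "a \<in> neighbours G v"
  obtains b c where "b \<in> neighbours G v" "c \<in> neighbours G v" "b \<noteq> c"
    "b \<in> neighbours G a" "c \<in> neighbours G a"
proof -
  obtain xs where xs: "distinct xs" "set xs = neighbours G v"
    "2 \<le> length xs \<longrightarrow> (\<forall>i<length xs. {xs ! i, xs ! (Suc i mod length xs)} \<in> edges G)"
    using maximal_planar_link[OF G] by blast
  let ?n = "length xs"
  have n: "3 \<le> ?n" using v xs(1,2) distinct_card by metis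
  have E: "{xs ! i, xs ! (Suc i mod ?n)} \<in> edges G" if "i < ?n" for i using xs(3) n that by simp
  obtain i where i: "i < ?n" "a = xs ! i" using a xs(2) by (metis in_set_conv_nth)
  define j where "j = Suc i mod ?n"
  define k where "k = (if i = 0 then ?n - 1 else i - 1)"
  have j: "j < ?n" unfolding j_def using n by (intro mod_less_divisor) linarith
  have k: "k < ?n" using i n by (auto simp: k_def)
  have ki: "Suc k mod ?n = i" using i n by (auto simp: k_def)
  have "j \<noteq> k" using i n by (cases "Suc i = ?n") (auto simp: j_def k_def split: if_splits)
  then have "xs ! j \<noteq> xs ! k" using xs(1) j k by (simp add: nth_eq_iff_index_eq)
  moreover have "xs ! j \<in> neighbours G a" using E[OF i(1)] i by (simp add: j_def neighbours_def)
  moreover have "xs ! k \<in> neighbours G a"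
    using E[OF k] i ki by (simp add: neighbours_def insert_commute)
  ultimately show thesis using that j k xs(2) nth_mem by blast
qed

text \<open>When degrees are at most four, a further vertex \<open>x\<close> behind the wheel around \<open>v\<close> completes the wheel to
an octahedron. The neighbour \<open>a\<close> has its four neighbours \<open>v\<close>, \<open>b\<close>, \<open>d\<close>, \<open>x\<close>; the
link of \<open>a\<close> makes \<open>x\<close> adjacent to \<open>b\<close> and \<open>d\<close>, as \<open>x\<close> is not adjacent to \<open>v\<close>. In the same way the link
of \<open>b\<close> makes \<open>x\<close> adjacent to \<open>c\<close>. Now all six vertices have full degree.\<close>

lemma octahedron_closes:
  assumes G: "maximal_planar G" and deg: "\<And>w. card (neighbours G w) \<le> 4"
    and N: "neighbours G v = {a, b, c, d}" and dist: "distinct [a, b, c, d]"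
    and cyc: "b \<in> neighbours G a" "c \<in> neighbours G b" "d \<in> neighbours G c" "a \<in> neighbours G d"
    and x: "x \<in> neighbours G a" "x \<notin> insert v (neighbours G v)"
  shows "verts G = {v, a, b, c, d, x}"
proof -
  have simple: "simple_graph G" using G by (rule maximal_planar_simple)
  note sym = neighbours_commute[of _ G]
  note irr = not_own_neighbour[OF simple]
  have full: "neighbours G w = {p, q, s, t}"
    if "p \<in> neighbours G w" "q \<in> neighbours G w" "s \<in> neighbours G w" "t \<in> neighbours G w"
      "distinct [p, q, s, t]" for w p q s t
  proof -
    have "card {p, q, s, t} = 4" using that(5) by simp
    then show ?thesis
      using that deg[of w] card_subset_eq[OF finite_neighbours[OF simple], of "{p, q, s, t}" w]
        card_mono[OF finite_neighbours[OF simple], of "{p, q, s, t}" w]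
      by auto
  qed
  have vN: "v \<noteq> a" "v \<noteq> b" "v \<noteq> c" "v \<noteq> d" using irr[of v] N by auto
  have va: "v \<in> neighbours G a" "v \<in> neighbours G b" "v \<in> neighbours G c" "v \<in> neighbours G d"
    using N sym by blast+
  have xne: "x \<noteq> v" "x \<noteq> a" "x \<noteq> b" "x \<noteq> c" "x \<noteq> d" "v \<notin> neighbours G x"
    using x N sym by auto
  have Na: "neighbours G a = {v, b, d, x}"
    using va cyc x sym dist vN xne by (intro full) auto
  obtain p q where "p \<in> {v, b, d, x}" "q \<in> {v, b, d, x}" "p \<noteq> q" "p \<in> neighbours G x" "q \<in> neighbours G x"
    using link_min_degree[OF G, of a x] Na dist vN xne by auto
  then have xb: "b \<in> neighbours G x" "d \<in> neighbours G x" using xne irr[of x] by auto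
  have Nb: "neighbours G b = {v, a, c, x}"
    using va cyc xb sym dist vN xne by (intro full) auto
  obtain p q where "p \<in> {v, a, c, x}" "q \<in> {v, a, c, x}" "p \<noteq> q" "p \<in> neighbours G x" "q \<in> neighbours G x"
    using link_min_degree[OF G, of b x] Nb dist vN xne by auto
  then have xc: "c \<in> neighbours G x" using xne irr[of x] by auto
  have Nc: "neighbours G c = {v, b, d, x}"
    using va cyc xc sym dist vN xne by (intro full) auto
  have Nd: "neighbours G d = {v, a, c, x}"
    using va cyc xb sym dist vN xne by (intro full) auto
  have Nx: "neighbours G x = {a, b, c, d}"
    using x(1) xb xc sym dist by (intro full) auto
  have "v \<in> verts G" "x \<in> verts G" "{a, b, c, d} \<subseteq> verts G"
    using neighbours_subset_verts[OF simple, of a] neighbours_subset_verts[OF simple, of v] va x N by auto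
  then have "{v, a, b, c, d, x} = verts G"
    using N Na Nb Nc Nd Nx by (intro maximal_planar_connected[OF G]) auto
  then show ?thesis by simp
qed

text \<open>This replaces the usual count of edges by Euler's formula. Suppose that the maximum degree is at
most four, and is attained at \<open>v\<close>. If it is at most three, then the neighbours of \<open>v\<close> are
pairwise adjacent and have no room for further neighbours, so \<open>v\<close> and its neighbours are the whole
graph; if it is four, the graph has five vertices or is the octahedron. The octahedron shows that seven
is the best bound.\<close>

lemma maximal_planar_has_degree_five:
  assumes G: "maximal_planar G" and large: "7 \<le> card (verts G)"
  shows "\<exists>v. 5 \<le> card (neighbours G v)"
proof (rule ccontr)
  assume none: "\<nexists>v. 5 \<le> card (neighbours G v)"
  have deg: "card (neighbours G w) \<le> 4" for w 
  proof -
    have "\<not> 5 \<le> card (neighbours G w)" using none by blast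
    then show ?thesis by linarith
  qed
  have simple: "simple_graph G" using G by (rule maximal_planar_simple)
  have fin: "finite (verts G)" using simple by (simp add: simple_graph_def)
  have "verts G \<noteq> {}" using large by auto
  then have "Max ((\<lambda>w. card (neighbours G w)) ` verts G) \<in> (\<lambda>w. card (neighbours G w)) ` verts G"
    using fin by (intro Max_in) auto
  then obtain v where v0: "v \<in> verts G" "card (neighbours G v) = Max ((\<lambda>w. card (neighbours G w)) ` verts G)"
    by auto
  then have v: "v \<in> verts G" "\<And>w. w \<in> verts G \<Longrightarrow> card (neighbours G w) \<le> card (neighbours G v)"
    using fin by (auto intro: Max_ge)
  let ?C = "insert v (neighbours G v)"
  have finN: "finite (neighbours G w)" for w using finite_neighbours[OF simple] .
  have "card ?C \<le> 5" using deg[of v] finN by (simp add: card_insert_if)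
  then have "?C \<noteq> verts G" using large by auto
  then obtain a where a: "a \<in> ?C" "\<not> neighbours G a \<subseteq> ?C"
    using maximal_planar_connected[OF G, of ?C] v(1) neighbours_subset_verts[OF simple] by blast
  then have aN: "a \<in> neighbours G v" by blast
  obtain x where x: "x \<in> neighbours G a" "x \<notin> ?C" using a(2) by blast
  have aV: "a \<in> verts G" using aN neighbours_subset_verts[OF simple] by blast
  obtain xs where xs: "distinct xs" "set xs = neighbours G v"
    "2 \<le> length xs \<longrightarrow> (\<forall>i<length xs. {xs ! i, xs ! (Suc i mod length xs)} \<in> edges G)"
    using maximal_planar_link[OF G] by blast
  have len: "length xs = card (neighbours G v)" using xs distinct_card by metis
  have rim: "{xs ! i, xs ! (Suc i mod length xs)} \<in> edges G" if "i < length xs" "2 \<le> length xs" for i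
    using xs(3) that by blast
  show False
  proof (cases "card (neighbours G v) \<le> 3")
    case True
    have clique: "b \<in> neighbours G a" if "b \<in> neighbours G v" "b \<noteq> a" for b
    proof -
      consider "length xs \<le> 1" | "length xs = 2" | "length xs = 3" using True len by linarith
      then show ?thesis
      proof cases
        case 1
        then show ?thesis using that aN unfolding xs(2)[symmetric] by (cases xs) auto
      next
        case 2
        then obtain p q where pq: "xs = [p, q]" by (auto simp: length_Suc_conv numeral_eq_Suc)
        have "{p, q} \<in> edges G" using rim[of 0] unfolding 2 by (simp add: pq)
        moreover have "a \<in> {p, q}" "b \<in> {p, q}" using that aN xs(2) pq by auto
        ultimately show ?thesis using that(2) by (auto simp: neighbours_def insert_commute)
      next
        case 3
        then obtain p q s where pqs: "xs = [p, q, s]" by (auto simp: length_Suc_conv numeral_eq_Suc)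
        have "{p, q} \<in> edges G" "{q, s} \<in> edges G" "{s, p} \<in> edges G"
          using rim[of 0] rim[of 1] rim[of 2] unfolding 3 by (simp_all add: pqs)
        moreover have "a \<in> {p, q, s}" "b \<in> {p, q, s}" using that aN xs(2) pqs by auto
        ultimately show ?thesis using that(2) by (auto simp: neighbours_def insert_commute)
      qed
    qed
    have "insert x (?C - {a}) \<subseteq> neighbours G a"
      using clique x aN neighbours_commute[of v G a] by auto
    then have "card (insert x (?C - {a})) \<le> card (neighbours G v)"
      using v(2)[OF aV] card_mono[OF finN] order_trans by blast
    moreover have "card (insert x (?C - {a})) = Suc (card (neighbours G v))"
      using x aN finN not_own_neighbour[OF simple, of v] by (simp add: card_Diff_singleton)
    ultimately show False by simp
  next
    case False
    then have four: "length xs = 4" using deg[of v] len by simp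
    then obtain p q s t where pqst: "xs = [p, q, s, t]"
      by (auto simp: length_Suc_conv numeral_eq_Suc)
    have E: "{p, q} \<in> edges G" "{q, s} \<in> edges G" "{s, t} \<in> edges G" "{t, p} \<in> edges G"
      using rim[of 0] rim[of 1] rim[of 2] rim[of 3] unfolding four by (simp_all add: pqst)
    have N: "neighbours G v = {p, q, s, t}" "distinct [p, q, s, t]" using xs pqst by auto
    have octahedron: False
      if "neighbours G v = {a, b, c, d}" "distinct [a, b, c, d]"
        "{a, b} \<in> edges G" "{b, c} \<in> edges G" "{c, d} \<in> edges G" "{d, a} \<in> edges G" for b c d
    proof -
      have "verts G = {v, a, b, c, d, x}"
        using that(3-) by (intro octahedron_closes[OF G deg that(1,2) _ _ _ _ x]) (simp_all add: neighbours_def)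
      then have "card (verts G) \<le> 6" using card_length[of "[v, a, b, c, d, x]"] by simp
      then show False using large by simp
    qed
    consider "a = p" | "a = q" | "a = s" | "a = t" using aN N(1) by blast
    then show False
    proof cases
      case 1
      show False by (rule octahedron[of q s t]) (use N E 1 in auto)
    next
      case 2
      have "neighbours G v = {a, s, t, p}" unfolding N(1) 2 by blast
      then show False by (rule octahedron) (use N(2) E 2 in auto)
    next
      case 3
      have "neighbours G v = {a, t, p, q}" unfolding N(1) 3 by blast
      then show False by (rule octahedron) (use N(2) E 3 in auto)
    next
      case 4
      have "neighbours G v = {a, p, q, s}" unfolding N(1) 4 by blast
      then show False by (rule octahedron) (use N(2) E 4 in auto)
    qed
  qed
qed

section \<open>Monochromatic paths in a wheel\<close>

definition coloured_nbrs :: "'a ugraph \<Rightarrow> ('a set \<Rightarrow> colour) \<Rightarrow> colour \<Rightarrow> 'a \<Rightarrow> 'a set" where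
  "coloured_nbrs G col c v = {w \<in> neighbours G v. col {v, w} = c}"

definition mono_path4 :: "'a ugraph \<Rightarrow> ('a set \<Rightarrow> colour) \<Rightarrow> colour \<Rightarrow> 'a list \<Rightarrow> bool" where
  "mono_path4 G col c p \<longleftrightarrow> length p = 4 \<and> distinct p \<and>
     (\<forall>i<3. {p ! i, p ! Suc i} \<in> edges G \<and> col {p ! i, p ! Suc i} = c)"

lemma mono_path4I:
  assumes "distinct [a, b, s, t]" "{a, b} \<in> edges G" "{b, s} \<in> edges G" "{s, t} \<in> edges G"
    "col {a, b} = c" "col {b, s} = c" "col {s, t} = c"
  shows "mono_path4 G col c [a, b, s, t]"
  using assms by (auto simp: mono_path4_def All_less_Suc numeral_eq_Suc)

lemma coloured_nbrs_three:
  assumes G: "simple_graph G" and v: "5 \<le> card (neighbours G v)"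
  shows "\<exists>c. 3 \<le> card (coloured_nbrs G col c v)"
proof (rule ccontr)
  assume none: "\<nexists>c. 3 \<le> card (coloured_nbrs G col c v)"
  have fin: "finite (coloured_nbrs G col c v)" for c
    using finite_neighbours[OF G] by (simp add: coloured_nbrs_def)
  have "neighbours G v = coloured_nbrs G col Red v \<union> coloured_nbrs G col Blue v"
    by (auto simp: coloured_nbrs_def intro: colour.exhaust)
  then have "card (neighbours G v) \<le> card (coloured_nbrs G col Red v) + card (coloured_nbrs G col Blue v)"
    by (simp add: card_Un_le)
  moreover have "\<not> 3 \<le> card (coloured_nbrs G col Red v)" "\<not> 3 \<le> card (coloured_nbrs G col Blue v)"
    using none by blast+
  ultimately show False using v by linarith
qed

lemma third_member:
  assumes "3 \<le> card S"
  shows "\<exists>z\<in>S. z \<noteq> x \<and> z \<noteq> y"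
proof (rule ccontr)
  assume "\<not> ?thesis"
  then have "S \<subseteq> {x, y}" by blast
  then have "card S \<le> card {x, y}" by (intro card_mono) auto
  also have "\<dots> \<le> 2" by (simp add: card_insert_if)
  finally show False using assms by simp
qed

text \<open>An edge \<open>{a, b}\<close> of colour \<open>c\<close> would extend the two-edge path through \<open>v\<close> that
ends in \<open>a\<close> and starts in a third vertex of the star.\<close>

lemma edges_leave_colour_star:
  assumes G: "simple_graph G" and three: "3 \<le> card (coloured_nbrs G col c v)"
    and no: "\<nexists>p. mono_path4 G col c p"
    and a: "a \<in> coloured_nbrs G col c v" and ab: "{a, b} \<in> edges G" "b \<noteq> v"
  shows "col {a, b} \<noteq> c"
proof
  assume col: "col {a, b} = c"
  obtain a' where a': "a' \<in> coloured_nbrs G col c v" "a' \<noteq> a" "a' \<noteq> b"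
    using third_member[OF three] by blast
  have irr: "x \<noteq> y" if "{x, y} \<in> edges G" for x y
    using G that by (force simp: simple_graph_def)
  have E: "{a', v} \<in> edges G" "col {a', v} = c" "{v, a} \<in> edges G" "col {v, a} = c"
    using a a' by (auto simp: coloured_nbrs_def neighbours_def insert_commute)
  have "mono_path4 G col c [a', v, a, b]"
    using E ab col a' irr[OF E(1)] irr[OF E(3)] irr[OF ab(1)] by (intro mono_path4I) auto
  then show False using no by blast
qed

lemma cyclic_index_distinct:
  assumes "distinct xs" "i < j" "j < i + length xs"
  shows "xs ! (i mod length xs) \<noteq> xs ! (j mod length xs)"
proof
  assume eq: "xs ! (i mod length xs) = xs ! (j mod length xs)"
  have pos: "0 < length xs" using assms by linarith
  then have "i mod length xs = j mod length xs"
    using eq assms(1) by (simp add: nth_eq_iff_index_eq)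
  then have "length xs dvd j - i" using assms(2) by (metis less_imp_le mod_eq_dvd_iff_nat)
  then show False using assms(2,3) by (auto dest: dvd_imp_le)
qed

text \<open>If no path of colour \<open>c\<close> exists, all rim edges at spokes of colour \<open>c\<close> have the other colour. Two
such spokes that are at most two steps apart on the rim already account for the three
consecutive rim edges from position \<open>j\<close> to position \<open>j + 3\<close>, which form the path.\<close>

lemma close_spokes_give_path:
  assumes G: "simple_graph G" and xs: "distinct xs" "set xs = neighbours G v" "4 \<le> length xs"
    and cyc: "\<And>i. {xs ! (i mod length xs), xs ! (Suc i mod length xs)} \<in> edges G"
    and three: "3 \<le> card (coloured_nbrs G col c v)"
    and close: "xs ! (Suc j mod length xs) \<in> coloured_nbrs G col c v"
      "xs ! ((j + 2) mod length xs) \<in> coloured_nbrs G col c v \<or>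
       xs ! ((j + 3) mod length xs) \<in> coloured_nbrs G col c v"
  shows "\<exists>c p. mono_path4 G col c p"
proof (rule ccontr)
  assume none: "\<not> ?thesis"
  define x where "x i = xs ! (i mod length xs)" for i
  have mem: "x i \<noteq> v" for i
  proof -
    have "i mod length xs < length xs" using xs(3) by (intro mod_less_divisor) linarith
    then have "x i \<in> neighbours G v" using xs(2) nth_mem by (auto simp: x_def)
    then show ?thesis using not_own_neighbour[OF G] by metis
  qed
  have E: "{x i, x (Suc i)} \<in> edges G" for i using cyc by (simp add: x_def)
  have out: "col {a, b} \<noteq> c" if "a \<in> coloured_nbrs G col c v" "{a, b} \<in> edges G" "b \<noteq> v" for a b
    using edges_leave_colour_star[OF G three _ that] none by blast
  have star: "x (Suc j) \<in> coloured_nbrs G col c v"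
     "x (Suc (Suc j)) \<in> coloured_nbrs G col c v \<or> x (Suc (Suc (Suc j))) \<in> coloured_nbrs G col c v"
    using close by (simp_all add: x_def numeral_eq_Suc)
  have 1: "col {x j, x (Suc j)} \<noteq> c"
    using out[OF star(1), of "x j"] E[of j] mem by (simp add: insert_commute)
  have 2: "col {x (Suc j), x (Suc (Suc j))} \<noteq> c"
    using out[OF star(1)] E mem by simp
  have 3: "col {x (Suc (Suc j)), x (Suc (Suc (Suc j)))} \<noteq> c"
    using star(2) out[of "x (Suc (Suc j))" "x (Suc (Suc (Suc j)))"]
      out[of "x (Suc (Suc (Suc j)))" "x (Suc (Suc j))"] E[of "Suc (Suc j)"] mem
    by (metis insert_commute)
  obtain c' where c': "\<And>k. k \<noteq> c \<Longrightarrow> k = c'" by (cases c) (metis colour.exhaust)+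
  have "distinct [x j, x (Suc j), x (Suc (Suc j)), x (Suc (Suc (Suc j)))]"
    using cyclic_index_distinct[OF xs(1)] xs(3) by (simp add: x_def)
  then have "mono_path4 G col c' [x j, x (Suc j), x (Suc (Suc j)), x (Suc (Suc (Suc j)))]"
    using E 1 2 3 c' by (intro mono_path4I) auto
  then show False using none by blast
qed

text \<open>Some colour \<open>c\<close> has three spokes at \<open>v\<close>. Start at one of them. If neither of the next two spokes has
colour \<open>c\<close>, these two form a close pair of the other colour. When the other colour has a third
spoke, that pair gives the path; when it has not, the two spokes after
the pair form a close pair of colour \<open>c\<close>.\<close>

lemma maximal_planar_mono_path4:
  assumes G: "maximal_planar G" and v: "5 \<le> card (neighbours G v)"
  shows "\<exists>c p. mono_path4 G col c p"
proof -
  have simple: "simple_graph G" using G by (rule maximal_planar_simple)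
  obtain xs where xs: "distinct xs" "set xs = neighbours G v"
    "2 \<le> length xs \<longrightarrow> (\<forall>i<length xs. {xs ! i, xs ! (Suc i mod length xs)} \<in> edges G)"
    using maximal_planar_link[OF G] by blast
  let ?n = "length xs"
  have n: "5 \<le> ?n" using v xs(1,2) distinct_card by metis
  have idx: "i mod ?n < ?n" for i using n by (intro mod_less_divisor) linarith
  have cyc: "{xs ! (i mod ?n), xs ! (Suc i mod ?n)} \<in> edges G" for i
  proof -
    have "2 \<le> ?n" using n by linarith
    then show ?thesis using xs(3) idx[of i] by (metis mod_Suc_eq)
  qed
  obtain c where c: "3 \<le> card (coloured_nbrs G col c v)"
    using coloured_nbrs_three[OF simple v] by blast
  define x where "x i = xs ! (i mod ?n)" for i
  have xN: "x i \<in> neighbours G v" for i using xs(2) nth_mem[OF idx] by (simp add: x_def)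
  have diff: "x i \<noteq> x j" if "i < j" "j < i + ?n" for i j
    using cyclic_index_distinct[OF xs(1) that] by (simp add: x_def)
  have close: ?thesis
    if "3 \<le> card (coloured_nbrs G col k v)" "x (Suc j) \<in> coloured_nbrs G col k v"
      "x (j + 2) \<in> coloured_nbrs G col k v \<or> x (j + 3) \<in> coloured_nbrs G col k v" for k j
    using close_spokes_give_path[OF simple xs(1,2) _ cyc, of col k j] that n by (simp add: x_def)
  obtain w where w: "w \<in> coloured_nbrs G col c v" using third_member[OF c] by blast
  then obtain m where m: "m < ?n" "w = xs ! m"
    using xs(2) by (metis (no_types, lifting) coloured_nbrs_def in_set_conv_nth mem_Collect_eq)
  \<comment> \<open>The rim index preceding \<open>m\<close> cyclically, so that \<open>x (Suc i)\<close> is \<open>w\<close>.\<close>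
  define i where "i = m + ?n - 1"
  have "Suc i = m + ?n" using n by (simp add: i_def)
  then have xi: "x (Suc i) \<in> coloured_nbrs G col c v" using w m by (simp add: x_def)
  show ?thesis
  proof (cases "x (i + 2) \<in> coloured_nbrs G col c v \<or> x (i + 3) \<in> coloured_nbrs G col c v")
    case True
    then show ?thesis using close[OF c xi] by blast
  next
    case False
    define c' where "c' = (if c = Red then Blue else Red)"
    have c': "k \<noteq> c \<longleftrightarrow> k = c'" for k by (cases k; cases c) (auto simp: c'_def)
    have in': "x (i + 2) \<in> coloured_nbrs G col c' v" "x (i + 3) \<in> coloured_nbrs G col c' v"
      using False xN c' by (auto simp: coloured_nbrs_def)
    show ?thesis
    proof (cases "3 \<le> card (coloured_nbrs G col c' v)")
      case True
      then show ?thesis using close[of c' "i + 1"] in' by (simp add: eval_nat_numeral)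
    next
      case False
      have fin: "finite (coloured_nbrs G col c' v)"
        using finite_neighbours[OF simple] by (simp add: coloured_nbrs_def)
      have "x (i + 2) \<noteq> x (i + 3)" using n by (intro diff) auto
      then have "card {x (i + 2), x (i + 3)} = 2" by simp
      then have eq: "coloured_nbrs G col c' v = {x (i + 2), x (i + 3)}"
        using False in' fin by (intro card_seteq[symmetric]) auto
      have "x (i + 2) \<noteq> x (i + 4)" "x (i + 3) \<noteq> x (i + 4)" "x (i + 2) \<noteq> x (i + 5)" "x (i + 3) \<noteq> x (i + 5)"
        using n diff[of "i + 2" "i + 4"] diff[of "i + 3" "i + 4"] diff[of "i + 2" "i + 5"] diff[of "i + 3" "i + 5"]
        by simp_all
      then have "x (i + 4) \<notin> coloured_nbrs G col c' v" "x (i + 5) \<notin> coloured_nbrs G col c' v"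
        unfolding eq by auto
      then have "x (i + 4) \<in> coloured_nbrs G col c v" "x (i + 5) \<in> coloured_nbrs G col c v"
        using xN c' unfolding coloured_nbrs_def by blast+
      then show ?thesis using close[OF c, of "i + 3"] by (simp add: eval_nat_numeral)
    qed
  qed
qed

section \<open>Trees on at most four vertices\<close>

lemma connected_graph_cut:
  assumes H: "simple_graph H" "connected_graph H" and S: "S \<subseteq> verts H" "S \<noteq> {}" "S \<noteq> verts H"
  shows "\<exists>u\<in>S. \<exists>w\<in>verts H - S. {u, w} \<in> edges H"
proof (rule ccontr)
  assume no: "\<not> ?thesis"
  obtain a b where ab: "a \<in> S" "b \<in> verts H" "b \<notin> S" using S by blast
  have "(a, b) \<in> {(x, y). {x, y} \<in> edges H}\<^sup>*"
    using H(2) ab S(1) unfolding connected_graph_def by blast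
  then have "b \<in> S"
  proof (induction rule: rtrancl_induct)
    case (step y z)
    then have "z \<in> verts H" "{y, z} \<in> edges H" using H(1) by (auto simp: simple_graph_def)
    then show ?case using no step.IH by blast
  qed (rule ab(1))
  then show False using ab by blast
qed

lemma tree_no_triangle:
  assumes "tree H" "{a, b} \<in> edges H" "{b, c} \<in> edges H" "{c, a} \<in> edges H"
    "distinct [a, b, c]"
  shows False
proof -
  have "is_cycle H [a, b, c]"
    using assms unfolding is_cycle_def by (auto simp: less_Suc_eq)
  then show False using assms(1) by (auto simp: tree_def)
qed

lemma tree_no_square:
  assumes "tree H" "{a, b} \<in> edges H" "{b, c} \<in> edges H" "{c, d} \<in> edges H" "{d, a} \<in> edges H"
    "distinct [a, b, c, d]"
  shows False
proof -
  have "is_cycle H [a, b, c, d]"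
    using assms unfolding is_cycle_def by (auto simp: less_Suc_eq)
  then show False using assms(1) by (auto simp: tree_def)
qed

text \<open>If some vertex is adjacent to all others, acyclicity forbids any further edge. Otherwise, growing
a connected set from one vertex cannot stop before four vertices, as a tree on at most three
vertices has a vertex adjacent to all others. For the same reason the fourth vertex is attached to an
end, not to the middle, of the path on the first three.\<close>

lemma small_tree_cases:
  assumes H: "tree H" and card: "card (verts H) \<le> 4"
  obtains (star) c where "c \<in> verts H" "\<And>e. e \<in> edges H \<Longrightarrow> \<exists>w\<in>verts H - {c}. e = {c, w}"
    | (path) a b c d where "distinct [a, b, c, d]" "verts H = {a, b, c, d}"
        "edges H \<subseteq> {{a, b}, {b, c}, {c, d}}"
proof (cases "\<exists>c\<in>verts H. \<forall>w\<in>verts H - {c}. {c, w} \<in> edges H")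
  case True
  have simple: "simple_graph H" using H by (simp add: tree_def)
  obtain c where c: "c \<in> verts H" "\<And>w. w \<in> verts H - {c} \<Longrightarrow> {c, w} \<in> edges H" using True by blast
  have "\<exists>w\<in>verts H - {c}. e = {c, w}" if e: "e \<in> edges H" for e
  proof -
    obtain a b where ab: "e = {a, b}" "a \<noteq> b"
      using simple e by (auto simp: simple_graph_def card_2_iff)
    have V: "a \<in> verts H" "b \<in> verts H" using simple e ab by (auto simp: simple_graph_def)
    have "a = c \<or> b = c"
    proof (rule ccontr)
      assume "\<not> ?thesis"
      then show False
        using tree_no_triangle[OF H, of c a b] c(2)[of a] c(2)[of b] V e ab by (auto simp: insert_commute)
    qed
    then show ?thesis using ab V by (auto simp: insert_commute)
  qed
  then show thesis using star c(1) by blast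
next
  case False
  have simple: "simple_graph H" and conn: "connected_graph H" using H by (auto simp: tree_def)
  have fin: "finite (verts H)" using simple by (simp add: simple_graph_def)
  have irr: "x \<noteq> y" "x \<in> verts H" "y \<in> verts H" if "{x, y} \<in> edges H" for x y
    using simple that by (force simp: simple_graph_def)+
  have nodom: "\<exists>w\<in>verts H - {c}. {c, w} \<notin> edges H" if "c \<in> verts H" for c using False that by blast
  obtain u where u: "u \<in> verts H" using conn by (auto simp: connected_graph_def)
  obtain w where w: "{u, w} \<in> edges H"
    using connected_graph_cut[OF simple conn, of "{u}"] u nodom[OF u] by blast
  have "{u, w} \<noteq> verts H" using nodom[OF u] w by auto
  then obtain y z where yz: "y \<in> {u, w}" "z \<in> verts H - {u, w}" "{y, z} \<in> edges H"
    using connected_graph_cut[OF simple conn, of "{u, w}"] irr[OF w] by auto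
  obtain a b c where abc: "{a, b} \<in> edges H" "{b, c} \<in> edges H" "distinct [a, b, c]"
  proof (cases "y = u")
    case True
    then show thesis using that[of w u z] w yz irr[OF w] by (auto simp: insert_commute)
  next
    case False
    then show thesis using that[of u w z] w yz irr[OF w] by auto
  qed
  have V: "a \<in> verts H" "b \<in> verts H" "c \<in> verts H" using abc irr by blast+
  have "{a, b, c} \<noteq> verts H" using nodom[OF V(2)] abc by (auto simp: insert_commute)
  then obtain x d where xd: "x \<in> {a, b, c}" "d \<in> verts H - {a, b, c}" "{x, d} \<in> edges H"
    using connected_graph_cut[OF simple conn, of "{a, b, c}"] V by auto
  have "card {a, b, c, d} = 4" using abc xd by auto
  then have VH: "verts H = {a, b, c, d}"
    using card V xd fin by (intro card_seteq[symmetric]) auto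
  have "x \<noteq> b" using nodom[OF V(2)] abc xd VH by (auto simp: insert_commute)
  have path_case: thesis
    if p: "{a, b} \<in> edges H" "{b, c} \<in> edges H" "{c, d} \<in> edges H" "distinct [a, b, c, d]"
      "verts H = {a, b, c, d}" for a b c d
  proof (rule path[OF p(4,5)])
    have "{a, c} \<notin> edges H" "{b, d} \<notin> edges H" "{a, d} \<notin> edges H"
      using tree_no_triangle[OF H, of a b c] tree_no_triangle[OF H, of b c d]
        tree_no_square[OF H, of a b c d] p by (auto simp: insert_commute)
    moreover have "\<exists>x y. e = {x, y} \<and> x \<noteq> y \<and> x \<in> {a, b, c, d} \<and> y \<in> {a, b, c, d}" if "e \<in> edges H" for e
      using simple that p(5) unfolding simple_graph_def card_2_iff by (metis insert_subset)
    ultimately show "edges H \<subseteq> {{a, b}, {b, c}, {c, d}}"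
      by (fastforce simp: insert_commute)
  qed
  show thesis
  proof (cases "x = c")
    case True
    then show thesis using path_case[of a b c d] abc xd VH by auto
  next
    case False
    then have "x = a" using xd \<open>x \<noteq> b\<close> by auto
    then show thesis using path_case[of c b a d] abc xd VH by (auto simp: insert_commute)
  qed
qed

section \<open>Unavoidability\<close>

lemma star_copy:
  assumes G: "simple_graph G" and three: "3 \<le> card (coloured_nbrs G col k v)"
    and H: "finite (verts H)" "card (verts H) \<le> 4" "c \<in> verts H"
    and star: "\<And>e. e \<in> edges H \<Longrightarrow> \<exists>w\<in>verts H - {c}. e = {c, w}"
  shows "has_mono_copy G col k H"
proof -
  let ?N = "coloured_nbrs G col k v"
  have finN: "finite ?N" using finite_neighbours[OF G] by (simp add: coloured_nbrs_def)
  have "card (verts H - {c}) \<le> card ?N" using H three by simp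
  then obtain g where g: "g ` (verts H - {c}) \<subseteq> ?N" "inj_on g (verts H - {c})"
    using card_le_inj[of "verts H - {c}" ?N] H(1) finN by auto
  let ?f = "g(c := v)"
  have vN: "v \<notin> ?N" using not_own_neighbour[OF G] by (auto simp: coloured_nbrs_def)
  have "?N \<noteq> {}" using three by auto
  then have vG: "v \<in> verts G" "?N \<subseteq> verts G"
    using neighbours_subset_verts[OF G] neighbours_commute[of _ G v] by (auto simp: coloured_nbrs_def)
  have "inj_on ?f (verts H)"
    using g vN by (auto simp: inj_on_def image_subset_iff)
  moreover have "?f ` verts H \<subseteq> verts G" using g vG by auto
  moreover have "?f ` e \<in> edges G \<and> col (?f ` e) = k" if e: "e \<in> edges H" for e
  proof -
    obtain w where w: "w \<in> verts H - {c}" "e = {c, w}" using star[OF e] by blast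
    then have "g w \<in> ?N" "?f ` e = {v, g w}" using g by auto
    then show ?thesis by (simp add: coloured_nbrs_def neighbours_def)
  qed
  ultimately show ?thesis unfolding has_mono_copy_def by blast
qed

lemma path4_copy:
  assumes G: "simple_graph G" and p: "mono_path4 G col k p"
    and H: "distinct [a, b, c, d]" "verts H = {a, b, c, d}" "edges H \<subseteq> {{a, b}, {b, c}, {c, d}}"
  shows "has_mono_copy G col k H"
proof -
  obtain s t u w where pl: "p = [s, t, u, w]"
    using p by (auto simp: mono_path4_def length_Suc_conv numeral_eq_Suc)
  have P: "distinct [s, t, u, w]" "{s, t} \<in> edges G" "{t, u} \<in> edges G" "{u, w} \<in> edges G"
      "col {s, t} = k" "col {t, u} = k" "col {u, w} = k"
    using p unfolding pl mono_path4_def by (auto simp: All_less_Suc numeral_eq_Suc)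
  have V: "{s, t, u, w} \<subseteq> verts G" using P G by (auto simp: simple_graph_def)
  let ?f = "(\<lambda>_. w)(a := s, b := t, c := u)"
  have "inj_on ?f (verts H)" "?f ` verts H \<subseteq> verts G"
    using H(1,2) P(1) V by auto
  moreover have "?f ` {a, b} = {s, t}" "?f ` {b, c} = {t, u}" "?f ` {c, d} = {u, w}"
    using H(1) by auto
  then have "?f ` e \<in> edges G \<and> col (?f ` e) = k" if "e \<in> edges H" for e
    using subsetD[OF H(3) that] P by (elim insertE emptyE) (simp_all only:)
  ultimately show ?thesis unfolding has_mono_copy_def by blast
qed

theorem corollary2:
  fixes H :: "'a ugraph"
  assumes "tree H" and "card (verts H) \<le> 4"
  shows "unavoidable (K_MP :: 'b ugraph set) H H"
proof -
  have "has_mono_copy G col Red H \<or> has_mono_copy G col Blue H"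
    if G: "G \<in> K_MP" and large: "7 \<le> card (verts G)" for G :: "'b ugraph" and col
  proof -
    have mp: "maximal_planar G" using G by (simp add: K_MP_def)
    have simple: "simple_graph G" using mp by (rule maximal_planar_simple)
    obtain v where v: "5 \<le> card (neighbours G v)"
      using maximal_planar_has_degree_five[OF mp large] by blast
    have "\<exists>k. has_mono_copy G col k H"
    proof (cases rule: small_tree_cases[OF assms])
      case (1 c)
      have "finite (verts H)" using assms(1) by (simp add: tree_def simple_graph_def)
      moreover obtain k where "3 \<le> card (coloured_nbrs G col k v)"
        using coloured_nbrs_three[OF simple v] by blast
      ultimately show ?thesis
        using star_copy[OF simple _ _ assms(2) 1] by blast
    next
      case (2 a b c d)
      obtain k p where "mono_path4 G col k p" using maximal_planar_mono_path4[OF mp v] by blast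
      then show ?thesis using path4_copy[OF simple _ 2] by blast
    qed
    then obtain k where "has_mono_copy G col k H" by blast
    then show ?thesis by (cases k) auto
  qed
  then show ?thesis unfolding unavoidable_def by (intro exI[of _ 7]) blast
qed

end
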